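(* Let $r:[\underline{\tau},\overline{\tau}]\to\mathbb{R}^2$, $\underline{\tau}<0<\overline{\tau}$, be a $C^{2k-1}$-class plane curve which has a unique equilibrium point $m=r(0)$ with respect to the origin $o$, where $k\ge 2$ is the order of the first nonzero derivative of the Euclidean distance function $\tau\mapsto|r(\tau)|$ at $\tau=0$. Let $F^{\Delta}$ be the $n$-element equidistant partition of $[\underline{\tau},\overline{\tau}]$, with $\Delta=\frac{\overline{\tau}-\underline{\tau}}{n}$, and let $N^{\Delta}(o)$ denote the number of equilibrium points, with respect to $o$, of the approximating polygon defined by $F^{\Delta}$. Then $N^{\Delta}(o)=\Theta\left(\Delta^{-\frac{k-2}{k-1}}\right)$, i.e. there are constants $C_1,C_2\in\mathbb{R}$ such that $$C_1\Delta^{-\frac{k-2}{k-1}}\le N^{\Delta}(o)\le C_2\Delta^{-\frac{k-2}{k-1}}$$ holds for all $\Delta>0$.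
   Context: The curve $r$ is regular ($\dot r\neq 0$), $m\neq o$, and $r$ is convex; in particular it is locally convex with respect to $o$ at $m$, meaning that, with $\rho=|m|>0$ and $\kappa$ the signed curvature of $r$ at $m$, one has $1+\kappa\rho<1$. An equilibrium point of $r$ with respect to $o$ is a point $r(\tau)$ at which the derivative of $\tau\mapsto|r(\tau)|$ vanishes. Here $n$ is a positive integer. The approximating polygon $P^{\Delta}$ defined by $F^{\Delta}$ is the polygonal curve whose consecutive vertices are the points $p_i=r(i\Delta)$, where $i\Delta$ runs over the division points of $F^{\Delta}$ (the indices $i$ are real numbers congruent mod $1$). There is a stable equilibrium point of $P^{\Delta}$ on the side $[p_i,p_{i+1}]$ if and only if $\langle p_i,p_{i+1}-p_i\rangle<0<\langle p_{i+1},p_{i+1}-p_i\rangle$; a vertex $p_i$ is an unstable equilibrium point of $P^{\Delta}$ if the distance from $o$, restricted to $P^{\Delta}$, has a local maximum at $p_i$. $N^{\Delta}(o)$ counts both kinds. These equilibria are assumed to be generic: if $P^{\Delta}$ has an equilibrium point at a vertex $p_i$, then the vector $p_i$ is perpendicular to neither $p_{i+1}-p_i$ nor $p_{i-1}-p_i$. $\Theta$ is the usual two-sided order-of-magnitude notation, so the constants are understood to be positive. *)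

theory Defs
  imports "HOL-Analysis.Analysis"
begin

text \<open>On a closed interval the derivatives at the end points are one-sided.\<close>

definition C_class_on :: "nat \<Rightarrow> real set \<Rightarrow> (real \<Rightarrow> 'a::real_normed_vector) \<Rightarrow> bool" where
  "C_class_on m S r \<longleftrightarrow>
     (\<exists>D :: nat \<Rightarrow> real \<Rightarrow> 'a.
        (\<forall>t\<in>S. D 0 t = r t) \<and>
        (\<forall>j<m. \<forall>t\<in>S. (D j has_vector_derivative D (Suc j) t) (at t within S)) \<and>
        continuous_on S (D m))"

definition regular_on :: "real set \<Rightarrow> (real \<Rightarrow> 'a::real_normed_vector) \<Rightarrow> bool" where
  "regular_on S r \<longleftrightarrow> (\<forall>t\<in>S. vector_derivative r (at t within S) \<noteq> 0)"

text \<open>A regular plane curve is convex if it lies on one side of each of its tangent lines;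
  below, \<open>\<nu>\<close> is a normal vector of the tangent line at \<open>r s\<close>.\<close>

definition convex_curve_on :: "real set \<Rightarrow> (real \<Rightarrow> real^2) \<Rightarrow> bool" where
  "convex_curve_on S r \<longleftrightarrow>
     (\<forall>s\<in>S. \<exists>\<nu>. \<nu> \<noteq> 0 \<and> \<nu> \<bullet> vector_derivative r (at s within S) = 0 \<and>
        (\<forall>t\<in>S. \<nu> \<bullet> (r t - r s) \<ge> 0))"

text \<open>Signed curvature at an interior parameter with respect to the unit normal \<open>\<nu>\<close>. It equals
  \<open>det (r', r'') / |r'|^3\<close> when \<open>\<nu>\<close> is \<open>r' / |r'|\<close> rotated by a right angle counterclockwise,
  and the negative of this for the opposite normal.\<close>

definition signed_curvature :: "(real \<Rightarrow> real^2) \<Rightarrow> real^2 \<Rightarrow> real \<Rightarrow> real" where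
  "signed_curvature r \<nu> t =
     vector_derivative (\<lambda>s. vector_derivative r (at s)) (at t) \<bullet> \<nu>
       / (norm (vector_derivative r (at t)))\<^sup>2"

text \<open>Local convexity with respect to the origin, \<open>1 + \<kappa> * \<rho> < 1\<close>, at an equilibrium point
  \<open>r t\<close>. The position vector is then normal to the curve, and the curvature is taken with respect
  to the outward normal \<open>r t / |r t|\<close>, so that \<open>\<kappa> < 0\<close> if the curve bends towards the origin.
  This is the sign for which the second derivative of \<open>|r|\<close> at \<open>t\<close> is
  \<open>|r'|^2 * (1 + \<kappa> * \<rho>) / \<rho>\<close>.\<close>

definition locally_convex_wrt_origin :: "(real \<Rightarrow> real^2) \<Rightarrow> real \<Rightarrow> bool" where
  "locally_convex_wrt_origin r t \<longleftrightarrow>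
     (let \<rho> = norm (r t); \<kappa> = signed_curvature r (r t /\<^sub>R \<rho>) t in 1 + \<kappa> * \<rho> < 1)"

definition curve_equilibrium :: "real set \<Rightarrow> (real \<Rightarrow> real^2) \<Rightarrow> real \<Rightarrow> bool" where
  "curve_equilibrium S r t \<longleftrightarrow>
     t \<in> S \<and> ((\<lambda>s. norm (r s)) has_real_derivative 0) (at t within S)"

definition first_nonzero_deriv_order :: "(real \<Rightarrow> real) \<Rightarrow> real \<Rightarrow> nat \<Rightarrow> bool" where
  "first_nonzero_deriv_order f t k \<longleftrightarrow>
     1 \<le> k \<and> (\<forall>j. 1 \<le> j \<and> j < k \<longrightarrow> (deriv ^^ j) f t = 0) \<and> (deriv ^^ k) f t \<noteq> 0"

text \<open>Polygonal curves are given by their consecutive vertices \<open>p 0, \<dots>, p n\<close>.\<close>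

definition polygon :: "(nat \<Rightarrow> real^2) \<Rightarrow> nat \<Rightarrow> (real^2) set" where
  "polygon p n = (\<Union>i<n. closed_segment (p i) (p (Suc i)))"

text \<open>Stable equilibria are the feet of the perpendiculars from the origin that lie in the relative
  interior of a side.\<close>

definition stable_equilibria :: "(nat \<Rightarrow> real^2) \<Rightarrow> nat \<Rightarrow> (real^2) set" where
  "stable_equilibria p n =
     {x. \<exists>i<n. x \<in> open_segment (p i) (p (Suc i)) \<and> x \<bullet> (p (Suc i) - p i) = 0}"

lemma ex1_stable_equilibrium_on_side_iff:
  fixes p q :: "real^2"
  shows "(\<exists>!x. x \<in> open_segment p q \<and> x \<bullet> (q - p) = 0) \<longleftrightarrow>
           p \<bullet> (q - p) < 0 \<and> 0 < q \<bullet> (q - p)" (is ?A)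
    and "(\<exists>x. x \<in> open_segment p q \<and> x \<bullet> (q - p) = 0) \<longleftrightarrow>
           p \<bullet> (q - p) < 0 \<and> 0 < q \<bullet> (q - p)" (is ?B)
proof -
  let ?d = "q - p"
  have inner_q: "q \<bullet> ?d = p \<bullet> ?d + ?d \<bullet> ?d"
    by (simp add: inner_diff_left)
  have pt: "((1 - u) *\<^sub>R p + u *\<^sub>R q) \<bullet> ?d = p \<bullet> ?d + u * (?d \<bullet> ?d)" for u
    by (simp add: algebra_simps inner_diff_left inner_diff_right inner_add_left)
  have nec: "p \<bullet> ?d < 0 \<and> 0 < q \<bullet> ?d \<and> x = (1 - u) *\<^sub>R p + u *\<^sub>R q \<and> u = - (p \<bullet> ?d) / (?d \<bullet> ?d)"
    if "p \<noteq> q" "0 < u" "u < 1" "x = (1 - u) *\<^sub>R p + u *\<^sub>R q" "x \<bullet> ?d = 0" for x u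
  proof -
    have pos: "?d \<bullet> ?d > 0" using that by simp
    have z: "p \<bullet> ?d + u * (?d \<bullet> ?d) = 0" using that pt by metis
    have "0 < u * (?d \<bullet> ?d)" "u * (?d \<bullet> ?d) < ?d \<bullet> ?d" using pos that by auto
    then have "p \<bullet> ?d < 0 \<and> 0 < q \<bullet> ?d" using z inner_q by linarith
    moreover have "u = - (p \<bullet> ?d) / (?d \<bullet> ?d)" using z pos by (simp add: field_simps)
    ultimately show ?thesis using that by blast
  qed
  have uniq: "x = y" if "x \<in> open_segment p q \<and> x \<bullet> ?d = 0"
    "y \<in> open_segment p q \<and> y \<bullet> ?d = 0" for x y
    using that nec unfolding in_segment by metis
  have suf: "\<exists>x. x \<in> open_segment p q \<and> x \<bullet> ?d = 0" if "p \<bullet> ?d < 0" "0 < q \<bullet> ?d"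
  proof -
    define u where "u = - (p \<bullet> ?d) / (?d \<bullet> ?d)"
    have ne: "p \<noteq> q" using that by auto
    then have pos: "?d \<bullet> ?d > 0" by simp
    have "0 < u" "u < 1" using that pos inner_q by (auto simp: u_def field_simps)
    moreover have "((1 - u) *\<^sub>R p + u *\<^sub>R q) \<bullet> ?d = 0"
      unfolding pt using pos by (simp add: u_def del: inner_gt_zero_iff)
    ultimately show ?thesis using ne unfolding in_segment by blast
  qed
  show ?B using nec suf unfolding in_segment by metis
  then show ?A using uniq by blast
qed

definition unstable_equilibria :: "(nat \<Rightarrow> real^2) \<Rightarrow> nat \<Rightarrow> (real^2) set" where
  "unstable_equilibria p n =
     {p i | i. i \<le> n \<and> (\<forall>\<^sub>F y in at (p i) within polygon p n. norm y \<le> norm (p i))}"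

definition polygon_equilibria :: "(nat \<Rightarrow> real^2) \<Rightarrow> nat \<Rightarrow> (real^2) set" where
  "polygon_equilibria p n = stable_equilibria p n \<union> unstable_equilibria p n"

definition num_polygon_equilibria :: "(nat \<Rightarrow> real^2) \<Rightarrow> nat \<Rightarrow> nat" where
  "num_polygon_equilibria p n = card (polygon_equilibria p n)"

text \<open>The first and the last vertex have only one neighbour.\<close>

definition generic_polygon :: "(nat \<Rightarrow> real^2) \<Rightarrow> nat \<Rightarrow> bool" where
  "generic_polygon p n \<longleftrightarrow>
     (\<forall>i\<le>n. p i \<in> polygon_equilibria p n \<longrightarrow>
        (i < n \<longrightarrow> p i \<bullet> (p (i + 1) - p i) \<noteq> 0) \<and>
        (0 < i \<longrightarrow> p i \<bullet> (p (i - 1) - p i) \<noteq> 0))"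

definition mesh :: "real \<Rightarrow> real \<Rightarrow> nat \<Rightarrow> real" where
  "mesh a b n = (b - a) / real n"

text \<open>The division points are enumerated as \<open>a + i * mesh a b n\<close> with \<open>i = 0, \<dots>, n\<close>.\<close>

definition approx_vertex :: "(real \<Rightarrow> real^2) \<Rightarrow> real \<Rightarrow> real \<Rightarrow> nat \<Rightarrow> nat \<Rightarrow> real^2" where
  "approx_vertex r a b n i = r (a + real i * mesh a b n)"

end

theory Submission
  imports Defs
begin

text \<open>
  Let \<open>f t = r t \<bullet> r t\<close>, let \<open>\<Delta>\<close> be the mesh and let \<open>p\<close>, \<open>q\<close> be the end points of a side. Since
  \<open>2 * (p \<bullet> (q - p)) = |q|^2 - |p|^2 - |q - p|^2\<close> and
  \<open>2 * (q \<bullet> (q - p)) = |q|^2 - |p|^2 + |q - p|^2\<close>, the side carries a stable equilibrium exactly when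
  the increment of \<open>f\<close> along it is smaller in absolute value than its squared length. The squared
  length is at most a multiple of \<open>\<Delta>^2\<close>, and near the equilibrium point of the curve also at least
  such a multiple; the increment is \<open>\<Delta> * f' \<xi>\<close> for some parameter \<open>\<xi>\<close> of the side. Up to constants,
  the sides near that point that carry an equilibrium are those at which \<open>|f'| \<le> \<Delta>\<close>. As \<open>f'\<close>
  vanishes there to order \<open>k - 1\<close>, they fill a parameter window of length of order
  \<open>\<Delta> powr (1 / (k - 1))\<close>, which contains about
  \<open>\<Delta> powr (1 / (k - 1)) / \<Delta> = \<Delta> powr (- (k - 2) / (k - 1))\<close> division points.

  \<^bold>\<open>Upper bound.\<close> The curve may pass through the origin, and there \<open>f'\<close> vanishes although \<open>|r|\<close> has
  no vanishing derivative; but such a zero of \<open>f'\<close> is simple. Hence near every parameter \<open>s\<close> there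
  is an estimate \<open>|f' t| \<ge> c * |t - s|^(k - 1)\<close> (\<open>inner_deriv_lower_bound_local\<close>), and by compactness
  finitely many centres \<open>s\<close> and one constant \<open>c\<close> serve the whole interval
  (\<open>compact_finite_centres\<close>). An unstable equilibrium at an inner vertex also forces \<open>|f'| \<le> L^2 * \<Delta>\<close>
  within distance \<open>\<Delta>\<close>: on the two adjacent sides \<open>f\<close> neither falls fast on the left nor rises fast
  on the right, and \<open>f'\<close> obeys the intermediate value theorem. So all equilibria but at most two lie in
  finitely many windows of the above length (\<open>num_approx_equilibria_le\<close>).

  \<^bold>\<open>Lower bound.\<close> In a window of that order next to \<open>0\<close> every side carries a stable equilibrium,
  and these are distinct because the curve advances there in the direction \<open>r' 0\<close>
  (\<open>num_approx_equilibria_ge\<close>). This yields the required number up to the loss of two incomplete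
  sides, which matters only for coarse partitions or \<open>k = 2\<close>; a vertex farthest from the origin
  is always an equilibrium and covers these cases (\<open>num_polygon_equilibria_pos\<close>).

  The order \<open>k\<close> is a property of \<open>|r|\<close> and its iterated derivatives. To turn it into
  estimates one needs that \<open>|r|\<close> is itself \<open>C^k\<close> where \<open>r\<close> does not vanish
  (\<open>C_class_on_norm\<close>); the Taylor formula for the derivative of \<open>|r|\<close> then gives the order of growth
  (\<open>deriv_bounds_of_first_nonzero_deriv_order\<close>).
\<close>

section \<open>Closure properties of the class of m times continuously differentiable functions\<close>

text \<open>This recursion makes the closure properties under sums, products, reciprocals and square roots
  inductions on the order, with the corresponding differentiation rule as the induction step.\<close>

lemma C_class_on_Suc:
  fixes f :: "real \<Rightarrow> 'a::real_normed_vector"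
  shows "C_class_on (Suc m) S f \<longleftrightarrow>
     (\<exists>g. (\<forall>t\<in>S. (f has_vector_derivative g t) (at t within S)) \<and> C_class_on m S g)"
proof
  assume "C_class_on (Suc m) S f"
  then obtain D where D: "\<forall>t\<in>S. D 0 t = f t"
      "\<forall>j<Suc m. \<forall>t\<in>S. (D j has_vector_derivative D (Suc j) t) (at t within S)"
      "continuous_on S (D (Suc m))"
    unfolding C_class_on_def by blast
  have "(f has_vector_derivative D 1 t) (at t within S)" if "t \<in> S" for t
    using has_vector_derivative_transform[of t S f "D 0" "D 1 t"] D(1,2) that by auto
  moreover have "C_class_on m S (D 1)"
    unfolding C_class_on_def
    by (intro exI[of _ "\<lambda>j. D (Suc j)"]) (use D in auto)
  ultimately show "\<exists>g. (\<forall>t\<in>S. (f has_vector_derivative g t) (at t within S)) \<and> C_class_on m S g"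
    by blast
next
  assume "\<exists>g. (\<forall>t\<in>S. (f has_vector_derivative g t) (at t within S)) \<and> C_class_on m S g"
  then obtain g D where g: "\<forall>t\<in>S. (f has_vector_derivative g t) (at t within S)"
      and D: "\<forall>t\<in>S. D 0 t = g t"
      "\<forall>j<m. \<forall>t\<in>S. (D j has_vector_derivative D (Suc j) t) (at t within S)"
      "continuous_on S (D m)"
    unfolding C_class_on_def by blast
  show "C_class_on (Suc m) S f"
    unfolding C_class_on_def
  proof (intro exI[of _ "\<lambda>j. case j of 0 \<Rightarrow> f | Suc i \<Rightarrow> D i"] conjI allI impI)
    fix j assume "j < Suc m"
    then show "\<forall>t\<in>S. ((case j of 0 \<Rightarrow> f | Suc i \<Rightarrow> D i) has_vector_derivative
        (case Suc j of 0 \<Rightarrow> f | Suc i \<Rightarrow> D i) t) (at t within S)"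
      using g D by (cases j) auto
  qed (use D in auto)
qed

lemma C_class_on_SucI:
  assumes "\<And>t. t \<in> S \<Longrightarrow> (f has_vector_derivative g t) (at t within S)" "C_class_on m S g"
  shows "C_class_on (Suc m) S f"
  using assms unfolding C_class_on_Suc by (intro exI[of _ g]) auto

lemma C_class_on_SucE:
  assumes "C_class_on (Suc m) S f"
  obtains g where "\<And>t. t \<in> S \<Longrightarrow> (f has_vector_derivative g t) (at t within S)" "C_class_on m S g"
  using assms unfolding C_class_on_Suc by auto

lemma C_class_on_SucD:
  assumes "C_class_on (Suc m) S f"
  shows "C_class_on m S f"
proof -
  obtain D where D: "\<forall>t\<in>S. D 0 t = f t"
      "\<forall>j<Suc m. \<forall>t\<in>S. (D j has_vector_derivative D (Suc j) t) (at t within S)"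
    using assms unfolding C_class_on_def by blast
  have "continuous_on S (D m)"
    using D(2) by (auto simp: continuous_on_eq_continuous_within intro: has_vector_derivative_continuous)
  then show ?thesis unfolding C_class_on_def using D by (intro exI[of _ D]) auto
qed

lemma C_class_on_mono:
  assumes "C_class_on m S f" "n \<le> m"
  shows "C_class_on n S f"
  using assms(2,1) by (induction rule: dec_induct) (auto dest: C_class_on_SucD)

lemma C_class_on_subset:
  assumes "C_class_on m S f" "T \<subseteq> S"
  shows "C_class_on m T f"
proof -
  obtain D where D: "\<forall>t\<in>S. D 0 t = f t"
      "\<forall>j<m. \<forall>t\<in>S. (D j has_vector_derivative D (Suc j) t) (at t within S)"
      "continuous_on S (D m)"
    using assms(1) unfolding C_class_on_def by blast
  have "(D j has_vector_derivative D (Suc j) t) (at t within T)" if "j < m" "t \<in> T" for j t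
    using has_vector_derivative_within_subset[OF _ assms(2)] D(2) that assms(2) by blast
  then show ?thesis
    unfolding C_class_on_def using D assms(2) continuous_on_subset[OF D(3) assms(2)]
    by (intro exI[of _ D]) auto
qed

lemma C_class_on_0 [simp]: "C_class_on 0 S f \<longleftrightarrow> continuous_on S f"
proof
  assume "C_class_on 0 S f"
  then obtain D where D: "\<forall>t\<in>S. D (0::nat) t = f t" "continuous_on S (D 0)"
    unfolding C_class_on_def by blast
  then show "continuous_on S f" using continuous_on_cong[of S S "D 0" f] by simp
next
  assume "continuous_on S f"
  then show "C_class_on 0 S f"
    unfolding C_class_on_def by (intro exI[of _ "\<lambda>_. f"]) auto
qed

lemma C_class_on_add:
  assumes "C_class_on m S f" "C_class_on m S g"
  shows "C_class_on m S (\<lambda>t. f t + g t)"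
  using assms
proof (induction m arbitrary: f g)
  case 0
  then show ?case by (simp add: continuous_on_add)
next
  case (Suc m)
  obtain f' g' where
    f: "\<And>t. t \<in> S \<Longrightarrow> (f has_vector_derivative f' t) (at t within S)" "C_class_on m S f'" and
    g: "\<And>t. t \<in> S \<Longrightarrow> (g has_vector_derivative g' t) (at t within S)" "C_class_on m S g'"
    using Suc.prems by (metis C_class_on_SucE)
  show ?case
    by (rule C_class_on_SucI[where g = "\<lambda>t. f' t + g' t"])
      (auto intro: f g Suc.IH has_vector_derivative_add)
qed

lemma C_class_on_inner:
  fixes f g :: "real \<Rightarrow> 'a::real_inner"
  assumes "C_class_on m S f" "C_class_on m S g"
  shows "C_class_on m S (\<lambda>t. f t \<bullet> g t)"
  using assms
proof (induction m arbitrary: f g)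
  case 0
  then show ?case by (simp add: continuous_on_inner)
next
  case (Suc m)
  obtain f' g' where
    f: "\<And>t. t \<in> S \<Longrightarrow> (f has_vector_derivative f' t) (at t within S)" "C_class_on m S f'" and
    g: "\<And>t. t \<in> S \<Longrightarrow> (g has_vector_derivative g' t) (at t within S)" "C_class_on m S g'"
    using Suc.prems by (metis C_class_on_SucE)
  have "C_class_on m S (\<lambda>t. f t \<bullet> g' t + f' t \<bullet> g t)"
    using Suc f(2) g(2) by (intro C_class_on_add Suc.IH) (auto dest: C_class_on_SucD)
  moreover have "((\<lambda>t. f t \<bullet> g t) has_vector_derivative f t \<bullet> g' t + f' t \<bullet> g t) (at t within S)"
    if "t \<in> S" for t
    using bounded_bilinear.has_vector_derivative[OF bounded_bilinear_inner] f(1) g(1) that by blast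
  ultimately show ?case by (intro C_class_on_SucI)
qed

lemma C_class_on_mult:
  fixes f g :: "real \<Rightarrow> real"
  assumes "C_class_on m S f" "C_class_on m S g"
  shows "C_class_on m S (\<lambda>t. f t * g t)"
  using C_class_on_inner[OF assms] by simp

lemma C_class_on_cmult:
  fixes f :: "real \<Rightarrow> real"
  assumes "C_class_on m S f"
  shows "C_class_on m S (\<lambda>t. c * f t)"
proof -
  have const: "C_class_on m S (\<lambda>t. d)" for d :: real
  proof (induction m arbitrary: d)
    case (Suc m)
    show ?case by (rule C_class_on_SucI[OF has_vector_derivative_const Suc])
  qed simp
  show ?thesis by (intro C_class_on_mult const assms)
qed

text \<open>The derivative \<open>- f' / f^2\<close> is a product of \<open>f'\<close> and two copies of \<open>1 / f\<close>, which by the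
  induction hypothesis are of the class one order lower.\<close>

lemma C_class_on_inverse:
  fixes f :: "real \<Rightarrow> real"
  assumes "C_class_on m S f" "\<forall>t\<in>S. f t \<noteq> 0"
  shows "C_class_on m S (\<lambda>t. inverse (f t))"
  using assms
proof (induction m arbitrary: f)
  case 0
  then show ?case by (simp add: continuous_on_inverse)
next
  case (Suc m)
  obtain f' where
    f: "\<And>t. t \<in> S \<Longrightarrow> (f has_vector_derivative f' t) (at t within S)" "C_class_on m S f'"
    using Suc.prems(1) by (metis C_class_on_SucE)
  have inv: "C_class_on m S (\<lambda>t. inverse (f t))"
    using Suc by (auto dest: C_class_on_SucD)
  have "C_class_on m S (\<lambda>t. (-1) * (inverse (f t) * (f' t * inverse (f t))))"
    by (intro C_class_on_mult C_class_on_cmult inv f(2))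
  moreover have "((\<lambda>t. inverse (f t)) has_vector_derivative
      (-1) * (inverse (f t) * (f' t * inverse (f t)))) (at t within S)" if "t \<in> S" for t
    using DERIV_inverse'[of f "f' t" t S] f(1) Suc.prems(2) that
    by (simp add: has_real_derivative_iff_has_vector_derivative mult.assoc)
  ultimately show ?case by (intro C_class_on_SucI)
qed

lemma C_class_on_sqrt:
  fixes f :: "real \<Rightarrow> real"
  assumes "C_class_on m S f" "\<forall>t\<in>S. f t > 0"
  shows "C_class_on m S (\<lambda>t. sqrt (f t))"
  using assms
proof (induction m arbitrary: f)
  case 0
  then show ?case by (simp add: continuous_on_real_sqrt)
next
  case (Suc m)
  obtain f' where
    f: "\<And>t. t \<in> S \<Longrightarrow> (f has_vector_derivative f' t) (at t within S)" "C_class_on m S f'"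
    using Suc.prems(1) by (metis C_class_on_SucE)
  have "C_class_on m S (\<lambda>t. inverse (sqrt (f t)))"
    using Suc by (intro C_class_on_inverse) (force dest: C_class_on_SucD)+
  then have "C_class_on m S (\<lambda>t. (1 / 2) * (inverse (sqrt (f t)) * f' t))"
    by (intro C_class_on_mult C_class_on_cmult f(2))
  moreover have "((\<lambda>t. sqrt (f t)) has_vector_derivative
      (1 / 2) * (inverse (sqrt (f t)) * f' t)) (at t within S)" if "t \<in> S" for t
    using DERIV_chain'[of f "f' t" t S sqrt, OF _ DERIV_real_sqrt] f(1) Suc.prems(2) that
    by (simp add: has_real_derivative_iff_has_vector_derivative field_simps)
  ultimately show ?case by (intro C_class_on_SucI)
qed

lemma C_class_on_norm:
  fixes r :: "real \<Rightarrow> 'a::real_inner"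
  assumes "C_class_on m S r" "\<forall>t\<in>S. r t \<noteq> 0"
  shows "C_class_on m S (\<lambda>t. norm (r t))"
  unfolding norm_eq_sqrt_inner using assms by (intro C_class_on_sqrt C_class_on_inner) auto

text \<open>On an open set the derivatives that witness the differentiability class agree with the iterates
  of \<^const>\<open>deriv\<close>, which are the ones that \<^const>\<open>first_nonzero_deriv_order\<close> speaks of.\<close>

lemma C_class_on_iterated_deriv:
  fixes h :: "real \<Rightarrow> real"
  assumes "C_class_on m S h" "open S"
  shows "\<And>j t. j < m \<Longrightarrow> t \<in> S \<Longrightarrow>
           ((deriv ^^ j) h has_real_derivative (deriv ^^ Suc j) h t) (at t)"
    and "continuous_on S ((deriv ^^ m) h)"
proof -
  obtain D where D: "\<forall>t\<in>S. D 0 t = h t"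
      "\<And>j t. j < m \<Longrightarrow> t \<in> S \<Longrightarrow> (D j has_real_derivative D (Suc j) t) (at t)"
      "continuous_on S (D m)"
    using assms at_within_open[OF _ assms(2)]
    unfolding C_class_on_def has_real_derivative_iff_has_vector_derivative by metis
  have eq: "j \<le> m \<Longrightarrow> t \<in> S \<Longrightarrow> (deriv ^^ j) h t = D j t" for j t
  proof (induction j arbitrary: t)
    case (Suc j)
    have "((deriv ^^ j) h has_real_derivative D (Suc j) t) (at t)"
      using DERIV_cong_ev[OF refl, of "(deriv ^^ j) h" "D j" t] Suc D(2)
        eventually_nhds_in_open[OF assms(2) Suc.prems(2)]
      by (smt (verit, del_insts) Suc_le_eq eventually_mono less_imp_le)
    then show ?case by (simp add: DERIV_imp_deriv)
  qed (use D in simp)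
  show "((deriv ^^ j) h has_real_derivative (deriv ^^ Suc j) h t) (at t)" if "j < m" "t \<in> S" for j t
  proof -
    have "((deriv ^^ j) h has_real_derivative D (Suc j) t) (at t)"
      using DERIV_cong_ev[OF refl, of "(deriv ^^ j) h" "D j" t] D(2) eq that
        eventually_nhds_in_open[OF assms(2) that(2)]
      by (smt (verit, del_insts) eventually_mono less_imp_le)
    then show ?thesis using eq that by (metis Suc_le_eq)
  qed
  show "continuous_on S ((deriv ^^ m) h)"
    using D(3) eq continuous_on_cong by (metis order_refl)
qed

section \<open>Order of growth of the derivative at a degenerate critical point\<close>

text \<open>By the Taylor formula of order \<open>k - 1\<close> for \<open>deriv h\<close>, in which only the remainder survives,
  \<open>deriv h t\<close> is \<open>t^(k - 1) / fact (k - 1)\<close> times a value of the \<open>k\<close>-th derivative close to its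
  nonzero value at \<open>0\<close>.\<close>

lemma deriv_bounds_of_first_nonzero_deriv_order:
  fixes h :: "real \<Rightarrow> real"
  assumes "C_class_on k {-\<eta><..<\<eta>} h" "\<eta> > 0" "first_nonzero_deriv_order h 0 k"
  obtains c C \<delta> where "c > 0" "C > 0" "\<delta> > 0" "\<delta> < \<eta>"
    "\<And>t. \<bar>t\<bar> \<le> \<delta> \<Longrightarrow> c * \<bar>t\<bar> ^ (k - 1) \<le> \<bar>deriv h t\<bar>"
    "\<And>t. \<bar>t\<bar> \<le> \<delta> \<Longrightarrow> \<bar>deriv h t\<bar> \<le> C * \<bar>t\<bar> ^ (k - 1)"
proof -
  note D = C_class_on_iterated_deriv[OF assms(1) open_greaterThanLessThan]
  define A where "A = \<bar>(deriv ^^ k) h 0\<bar>"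
  have k: "1 \<le> k" and z: "\<And>j. 1 \<le> j \<Longrightarrow> j < k \<Longrightarrow> (deriv ^^ j) h 0 = 0" and A: "A > 0"
    using assms(3) unfolding first_nonzero_deriv_order_def A_def by auto
  have "isCont ((deriv ^^ k) h) 0"
    using D(2) assms(2) by (simp add: continuous_on_eq_continuous_at)
  then obtain d where d: "d > 0" "\<And>t. \<bar>t\<bar> < d \<Longrightarrow> \<bar>(deriv ^^ k) h t - (deriv ^^ k) h 0\<bar> < A / 2"
    using A unfolding continuous_at_eps_delta dist_real_def by (metis diff_zero half_gt_zero)
  define \<delta> where "\<delta> = min d \<eta> / 2"
  have \<delta>: "\<delta> > 0" "\<delta> < \<eta>" "\<delta> < d" using d assms(2) by (auto simp: \<delta>_def)
  have main: "A / (2 * fact (k - 1)) * \<bar>t\<bar> ^ (k - 1) \<le> \<bar>deriv h t\<bar> \<and>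
      \<bar>deriv h t\<bar> \<le> 2 * A / fact (k - 1) * \<bar>t\<bar> ^ (k - 1)" if "\<bar>t\<bar> \<le> \<delta>" for t
  proof -
    have "\<exists>\<xi>. \<bar>\<xi>\<bar> \<le> \<bar>t\<bar> \<and> deriv h t = (\<Sum>m<k - 1. (deriv ^^ Suc m) h 0 / fact m * t ^ m) +
        (deriv ^^ Suc (k - 1)) h \<xi> / fact (k - 1) * t ^ (k - 1)"
    proof (rule Maclaurin_bi_le)
      show "\<forall>m u. m < k - 1 \<and> \<bar>u\<bar> \<le> \<bar>t\<bar> \<longrightarrow>
          ((deriv ^^ Suc m) h has_real_derivative (deriv ^^ Suc (Suc m)) h u) (at u)"
        by (intro allI impI D(1)) (use that \<delta> in auto)
    qed simp
    then obtain \<xi> where \<xi>: "\<bar>\<xi>\<bar> \<le> \<bar>t\<bar>" and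
      eq: "deriv h t = (\<Sum>m<k - 1. (deriv ^^ Suc m) h 0 / fact m * t ^ m) +
        (deriv ^^ Suc (k - 1)) h \<xi> / fact (k - 1) * t ^ (k - 1)" by blast
    have "(\<Sum>m<k - 1. (deriv ^^ Suc m) h 0 / fact m * t ^ m) = 0"
      by (intro sum.neutral) (use z in \<open>auto simp del: funpow.simps\<close>)
    then have "deriv h t = (deriv ^^ k) h \<xi> / fact (k - 1) * t ^ (k - 1)"
      using eq k by (simp del: funpow.simps)
    then have 1: "\<bar>deriv h t\<bar> = \<bar>(deriv ^^ k) h \<xi>\<bar> * (\<bar>t\<bar> ^ (k - 1) / fact (k - 1))"
      by (simp add: abs_mult power_abs)
    have "A / 2 \<le> \<bar>(deriv ^^ k) h \<xi>\<bar>" "\<bar>(deriv ^^ k) h \<xi>\<bar> \<le> 2 * A"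
      using d(2)[of \<xi>] \<xi> that \<delta> unfolding A_def by linarith+
    then show ?thesis
      using mult_right_mono[of "A / 2" "\<bar>(deriv ^^ k) h \<xi>\<bar>" "\<bar>t\<bar> ^ (k - 1) / fact (k - 1)"]
        mult_right_mono[of "\<bar>(deriv ^^ k) h \<xi>\<bar>" "2 * A" "\<bar>t\<bar> ^ (k - 1) / fact (k - 1)"]
      unfolding 1 by simp
  qed
  show thesis
    by (rule that[of "A / (2 * fact (k - 1))" "2 * A / fact (k - 1)" \<delta>]) (use A \<delta> main in auto)
qed

lemma has_real_derivative_norm_curve:
  fixes r :: "real \<Rightarrow> 'a::real_inner"
  assumes "(r has_vector_derivative d) (at t within S)" "r t \<noteq> 0"
  shows "((\<lambda>t. norm (r t)) has_real_derivative (r t \<bullet> d) / norm (r t)) (at t within S)"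
proof -
  have "((\<lambda>t. r t \<bullet> r t) has_vector_derivative r t \<bullet> d + d \<bullet> r t) (at t within S)"
    using bounded_bilinear.has_vector_derivative[OF bounded_bilinear_inner assms(1) assms(1)] .
  then have "((\<lambda>t. r t \<bullet> r t) has_real_derivative 2 * (r t \<bullet> d)) (at t within S)"
    by (simp add: has_real_derivative_iff_has_vector_derivative inner_commute)
  from DERIV_chain'[OF this DERIV_real_sqrt] show ?thesis
    using assms(2) by (simp add: norm_eq_sqrt_inner[symmetric] field_simps)
qed

text \<open>The function \<open>r \<bullet> r'\<close> is half the derivative of \<open>|r|^2\<close>. It equals \<open>|r|\<close> times the derivative of
  \<open>|r|\<close>, and near \<open>0\<close> the factor \<open>|r|\<close> lies between two positive constants.\<close>

lemma inner_deriv_bounds_at_critical_point: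
  fixes r r' :: "real \<Rightarrow> 'a::real_inner"
  assumes ab: "a < 0" "0 < b"
    and r: "\<And>t. t \<in> {a..b} \<Longrightarrow> (r has_vector_derivative r' t) (at t within {a..b})"
    and "r 0 \<noteq> 0" and "C_class_on k {a..b} r"
    and "first_nonzero_deriv_order (\<lambda>t. norm (r t)) 0 k"
  obtains c C \<delta> where "c > 0" "C > 0" "\<delta> > 0" "\<delta> \<le> - a" "\<delta> \<le> b"
    "\<And>t. \<bar>t\<bar> \<le> \<delta> \<Longrightarrow> c * \<bar>t\<bar> ^ (k - 1) \<le> \<bar>r t \<bullet> r' t\<bar>"
    "\<And>t. \<bar>t\<bar> \<le> \<delta> \<Longrightarrow> \<bar>r t \<bullet> r' t\<bar> \<le> C * \<bar>t\<bar> ^ (k - 1)"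
proof -
  let ?R = "norm (r 0)"
  have R: "?R > 0" using assms(4) by simp
  have "(r \<longlongrightarrow> r 0) (at 0 within {a..b})"
    using has_vector_derivative_continuous[OF r[of 0]] ab by (simp add: continuous_within)
  then have "\<forall>\<^sub>F t in at 0 within {a..b}. dist (r t) (r 0) < ?R / 2"
    by (rule tendstoD) (use R in simp)
  then obtain d where d: "d > 0"
      "\<And>t. t \<in> {a..b} \<Longrightarrow> t \<noteq> 0 \<Longrightarrow> dist t 0 < d \<Longrightarrow> dist (r t) (r 0) < ?R / 2"
    unfolding eventually_at by blast
  define \<eta> where "\<eta> = min d (min (- a) b)"
  have \<eta>: "\<eta> > 0" "\<eta> \<le> - a" "\<eta> \<le> b" "\<eta> \<le> d" using d ab by (auto simp: \<eta>_def)
  have size: "?R / 2 \<le> norm (r t)" "norm (r t) \<le> 2 * ?R" if "\<bar>t\<bar> < \<eta>" for t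
  proof -
    have "norm (r t - r 0) \<le> ?R / 2"
    proof (cases "t = 0")
      case False
      have "t \<in> {a..b}" "dist t 0 < d" using that \<eta> by auto
      then show ?thesis using d(2)[of t] False by (simp add: dist_norm)
    qed simp
    moreover have "\<bar>norm (r t) - ?R\<bar> \<le> norm (r t - r 0)" by (rule norm_triangle_ineq3)
    ultimately show "?R / 2 \<le> norm (r t)" "norm (r t) \<le> 2 * ?R" using R by linarith+
  qed
  have nz: "r t \<noteq> 0" if "\<bar>t\<bar> < \<eta>" for t using size(1)[OF that] R by auto
  have "C_class_on k {-\<eta><..<\<eta>} (\<lambda>t. norm (r t))"
  proof (rule C_class_on_norm)
    show "C_class_on k {-\<eta><..<\<eta>} r" by (rule C_class_on_subset[OF assms(5)]) (use \<eta> in auto)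
    show "\<forall>t\<in>{-\<eta><..<\<eta>}. r t \<noteq> 0" using nz by (auto simp: abs_less_iff)
  qed
  then obtain c C \<delta> where cC: "c > 0" "C > 0" "\<delta> > 0" "\<delta> < \<eta>"
    "\<And>t. \<bar>t\<bar> \<le> \<delta> \<Longrightarrow> c * \<bar>t\<bar> ^ (k - 1) \<le> \<bar>deriv (\<lambda>t. norm (r t)) t\<bar>"
    "\<And>t. \<bar>t\<bar> \<le> \<delta> \<Longrightarrow> \<bar>deriv (\<lambda>t. norm (r t)) t\<bar> \<le> C * \<bar>t\<bar> ^ (k - 1)"
    using deriv_bounds_of_first_nonzero_deriv_order[OF _ \<eta>(1) assms(6)] by metis
  have eq: "\<bar>r t \<bullet> r' t\<bar> = norm (r t) * \<bar>deriv (\<lambda>t. norm (r t)) t\<bar>" if "\<bar>t\<bar> < \<eta>" for t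
  proof -
    have "t \<in> {a..b}" "t \<in> interior {a..b}" using that \<eta> by auto
    then have "((\<lambda>t. norm (r t)) has_real_derivative (r t \<bullet> r' t) / norm (r t)) (at t)"
      using has_real_derivative_norm_curve[OF r nz[OF that]] by (metis at_within_interior)
    then show ?thesis using nz[OF that] by (simp add: DERIV_imp_deriv)
  qed
  show thesis
  proof (rule that[of "?R / 2 * c" "2 * ?R * C" \<delta>])
    fix t assume t: "\<bar>t\<bar> \<le> \<delta>"
    then have t': "\<bar>t\<bar> < \<eta>" using cC(4) by simp
    show "?R / 2 * c * \<bar>t\<bar> ^ (k - 1) \<le> \<bar>r t \<bullet> r' t\<bar>"
      unfolding eq[OF t'] mult.assoc
      by (rule mult_mono[OF size(1)[OF t'] cC(5)[OF t], unfolded mult.assoc]) (use cC in auto)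
    show "\<bar>r t \<bullet> r' t\<bar> \<le> 2 * ?R * C * \<bar>t\<bar> ^ (k - 1)"
      using mult_mono[OF size(2)[OF t'] cC(6)[OF t]] unfolding eq[OF t'] by (simp add: mult.assoc)
  qed (use R cC \<eta> in auto)
qed

text \<open>Three kinds of parameters occur: \<open>r \<bullet> r'\<close> does not vanish at \<open>s\<close>; the curve passes through the
  origin at \<open>s\<close>, where the derivative of \<open>r \<bullet> r'\<close> is \<open>|r' s|^2 > 0\<close>, so that its zero is simple;
  or \<open>s\<close> is the critical point \<open>t0\<close> of the distance. As \<open>m \<ge> 1\<close>, the bounds of order 0 and 1 in
  the first two cases imply one of order \<open>m\<close> close to \<open>s\<close>, so that one exponent serves all of them.\<close>

lemma inner_deriv_lower_bound_local:
  fixes r r' r'' :: "real \<Rightarrow> 'a::real_inner"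
  assumes r: "\<And>t. t \<in> S \<Longrightarrow> (r has_vector_derivative r' t) (at t within S)"
    and r': "\<And>t. t \<in> S \<Longrightarrow> (r' has_vector_derivative r'' t) (at t within S)"
    and reg: "\<And>t. t \<in> S \<Longrightarrow> r' t \<noteq> 0"
    and eq: "\<And>t. t \<in> S \<Longrightarrow> ((\<lambda>t. norm (r t)) has_real_derivative 0) (at t within S) \<Longrightarrow> t = t0"
    and t0: "c0 > 0" "\<delta>0 > 0"
      "\<And>t. t \<in> S \<Longrightarrow> dist t0 t < \<delta>0 \<Longrightarrow> c0 * dist t0 t ^ m \<le> \<bar>r t \<bullet> r' t\<bar>"
    and "m \<ge> 1" "s \<in> S"
  shows "\<exists>c>0. \<exists>\<delta>>0. \<forall>t\<in>S. dist s t < \<delta> \<longrightarrow> c * dist s t ^ m \<le> \<bar>r t \<bullet> r' t\<bar>"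
proof -
  let ?\<phi> = "\<lambda>t. r t \<bullet> r' t"
  have \<phi>: "(?\<phi> has_real_derivative r s \<bullet> r'' s + r' s \<bullet> r' s) (at s within S)"
    using bounded_bilinear.has_vector_derivative[OF bounded_bilinear_inner r[OF assms(9)] r'[OF assms(9)]]
    by (simp add: has_real_derivative_iff_has_vector_derivative)
  have small: "dist s t ^ m \<le> dist s t" if "dist s t < 1" for t
    using power_decreasing[of 1 m "dist s t"] that assms(8) by simp
  consider "?\<phi> s \<noteq> 0" | "r s = 0" | "?\<phi> s = 0" "r s \<noteq> 0" by blast
  then show ?thesis
  proof cases
    case 1
    have "(?\<phi> \<longlongrightarrow> ?\<phi> s) (at s within S)"
      using DERIV_continuous[OF \<phi>] by (simp add: continuous_within)
    then have "\<forall>\<^sub>F t in at s within S. dist (?\<phi> t) (?\<phi> s) < \<bar>?\<phi> s\<bar> / 2"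
      by (rule tendstoD) (use 1 in simp)
    then obtain d where d: "d > 0"
        "\<And>t. t \<in> S \<Longrightarrow> t \<noteq> s \<Longrightarrow> dist t s < d \<Longrightarrow> dist (?\<phi> t) (?\<phi> s) < \<bar>?\<phi> s\<bar> / 2"
      unfolding eventually_at by blast
    have "\<bar>?\<phi> s\<bar> / 2 * dist s t ^ m \<le> \<bar>?\<phi> t\<bar>" if t: "t \<in> S" "dist s t < min d 1" for t
    proof -
      have "dist (?\<phi> t) (?\<phi> s) < \<bar>?\<phi> s\<bar> / 2"
        using d(2)[of t] t 1 by (cases "t = s") (auto simp: dist_commute)
      then have "\<bar>?\<phi> s\<bar> / 2 \<le> \<bar>?\<phi> t\<bar>" unfolding dist_real_def by linarith
      moreover have "\<bar>?\<phi> s\<bar> / 2 * dist s t ^ m \<le> \<bar>?\<phi> s\<bar> / 2 * 1"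
        using small[of t] t by (intro mult_left_mono) auto
      ultimately show ?thesis by linarith
    qed
    then show ?thesis
      using 1 d(1) by (intro exI[of _ "\<bar>?\<phi> s\<bar> / 2"] exI[of _ "min d 1"] conjI) auto
  next
    case 2
    let ?A = "r' s \<bullet> r' s"
    have A: "?A > 0" using reg assms(9) by simp
    have "((\<lambda>t. ?\<phi> t / (t - s)) \<longlongrightarrow> ?A) (at s within S)"
      using \<phi> 2 unfolding has_field_derivative_iff by simp
    then have "\<forall>\<^sub>F t in at s within S. dist (?\<phi> t / (t - s)) ?A < ?A / 2"
      by (rule tendstoD) (use A in simp)
    then obtain d where d: "d > 0"
        "\<And>t. t \<in> S \<Longrightarrow> t \<noteq> s \<Longrightarrow> dist t s < d \<Longrightarrow> dist (?\<phi> t / (t - s)) ?A < ?A / 2"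
      unfolding eventually_at by blast
    have "?A / 2 * dist s t ^ m \<le> \<bar>?\<phi> t\<bar>" if t: "t \<in> S" "dist s t < min d 1" for t
    proof (cases "t = s")
      case True
      then show ?thesis using assms(8) by (simp add: power_0_left)
    next
      case False
      have "dist (?\<phi> t / (t - s)) ?A < ?A / 2" using d(2)[of t] t False by (simp add: dist_commute)
      then have "?A / 2 \<le> \<bar>?\<phi> t / (t - s)\<bar>" unfolding dist_real_def by linarith
      then have "?A / 2 * \<bar>t - s\<bar> \<le> \<bar>?\<phi> t\<bar>" using False by (simp add: field_simps abs_divide)
      moreover have "?A / 2 * dist s t ^ m \<le> ?A / 2 * \<bar>t - s\<bar>"
        using small[of t] t A by (intro mult_left_mono) (auto simp: dist_real_def)
      ultimately show ?thesis by linarith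
    qed
    then show ?thesis
      using A d(1) by (intro exI[of _ "?A / 2"] exI[of _ "min d 1"] conjI) auto
  next
    case 3
    have "s = t0"
      using eq[OF assms(9)] has_real_derivative_norm_curve[OF r[OF assms(9)] 3(2)] 3(1) by simp
    then show ?thesis using t0 by blast
  qed
qed

lemma compact_finite_centres:
  fixes S :: "'a::metric_space set" and G :: "'a \<Rightarrow> real"
  assumes "compact S"
    and local: "\<And>s. s \<in> S \<Longrightarrow> \<exists>c>0. \<exists>\<delta>>0. \<forall>t\<in>S. dist s t < \<delta> \<longrightarrow> c * dist s t ^ m \<le> G t"
  obtains F c where "finite F" "c > 0" "\<And>t. t \<in> S \<Longrightarrow> \<exists>s\<in>F. c * dist s t ^ m \<le> G t"
proof -
  obtain c \<delta> where pos: "\<And>s. s \<in> S \<Longrightarrow> c s > 0 \<and> \<delta> s > 0"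
      and le: "\<And>s t. s \<in> S \<Longrightarrow> t \<in> S \<Longrightarrow> dist s t < \<delta> s \<Longrightarrow> c s * dist s t ^ m \<le> G t"
    using local by metis
  obtain F where F: "F \<subseteq> S" "finite F" "S \<subseteq> (\<Union>s\<in>F. ball s (\<delta> s))"
    by (rule compactE_image[OF assms(1), of S "\<lambda>s. ball s (\<delta> s)"]) (use pos in force)+
  define c0 where "c0 = Min (insert 1 (c ` F))"
  have c0: "c0 > 0" "\<And>s. s \<in> F \<Longrightarrow> c0 \<le> c s"
    using F pos unfolding c0_def by (auto simp: Min_gr_iff subset_iff)
  show thesis
  proof (rule that[OF F(2) c0(1)])
    fix t assume t: "t \<in> S"
    then obtain s where s: "s \<in> F" "dist s t < \<delta> s" using F(3) by auto
    have "c0 * dist s t ^ m \<le> c s * dist s t ^ m" using c0 s by (intro mult_right_mono) auto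
    also have "\<dots> \<le> G t" using le s t F(1) by blast
    finally show "\<exists>s\<in>F. c0 * dist s t ^ m \<le> G t" using s by blast
  qed
qed

section \<open>Equilibria of polygons\<close>

text \<open>Twice the two inner products are \<open>|q|^2 - |p|^2 - |q - p|^2\<close> and \<open>|q|^2 - |p|^2 + |q - p|^2\<close>. The left
  side is the condition for a stable equilibrium on a side; the right side can be compared with a
  derivative.\<close>

lemma stable_foot_iff:
  fixes p q :: "'a::real_inner"
  shows "p \<bullet> (q - p) < 0 \<and> 0 < q \<bullet> (q - p) \<longleftrightarrow> \<bar>q \<bullet> q - p \<bullet> p\<bar> < (norm (q - p))\<^sup>2"
  unfolding power2_norm_eq_inner by (auto simp: inner_diff inner_commute)

text \<open>Otherwise the norm would increase when moving from \<open>p\<close> towards \<open>q\<close>.\<close>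

lemma local_max_norm_imp_inner_le_0:
  fixes p q :: "'a::real_inner"
  assumes "closed_segment p q \<subseteq> P" "\<forall>\<^sub>F y in at p within P. norm y \<le> norm p"
  shows "p \<bullet> (q - p) \<le> 0"
proof (rule ccontr)
  assume "\<not> ?thesis"
  then have pos: "p \<bullet> (q - p) > 0" by simp
  then have ne: "norm (q - p) > 0" by auto
  obtain d where d: "d > 0" "\<And>y. y \<in> P \<Longrightarrow> y \<noteq> p \<Longrightarrow> dist y p < d \<Longrightarrow> norm y \<le> norm p"
    using assms(2) unfolding eventually_at by blast
  define s where "s = min 1 (d / (2 * norm (q - p)))"
  define y where "y = p + s *\<^sub>R (q - p)"
  have s: "0 < s" "s \<le> 1" using d ne by (auto simp: s_def)
  have "s * norm (q - p) \<le> d / (2 * norm (q - p)) * norm (q - p)"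
    by (intro mult_right_mono) (auto simp: s_def)
  then have "dist y p < d" using d ne s by (auto simp: y_def dist_norm)
  moreover have "y \<in> closed_segment p q"
    using s by (auto simp: y_def in_segment algebra_simps intro!: exI[of _ s])
  moreover have "y \<noteq> p" using s ne by (auto simp: y_def)
  ultimately have "norm y \<le> norm p" using d assms(1) by blast
  then have "y \<bullet> y \<le> p \<bullet> p" by (simp add: norm_le)
  moreover have "y \<bullet> y = p \<bullet> p + 2 * s * (p \<bullet> (q - p)) + s\<^sup>2 * ((q - p) \<bullet> (q - p))"
    unfolding y_def inner_add_left inner_add_right
    by (simp add: inner_commute power2_eq_square)
  moreover have "s * (p \<bullet> (q - p)) > 0" using s pos by simp
  moreover have "s\<^sup>2 * ((q - p) \<bullet> (q - p)) \<ge> 0" by simp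
  ultimately show False by linarith
qed

lemma finite_unstable_equilibria: "finite (unstable_equilibria p n)"
proof -
  have "unstable_equilibria p n \<subseteq> p ` {..n}" unfolding unstable_equilibria_def by auto
  then show ?thesis by (rule finite_subset) simp
qed

text \<open>A side carries at most one stable equilibrium, so a choice of one for each such side
  enumerates them all.\<close>

lemma stable_equilibria_subset_image:
  "\<exists>x. stable_equilibria p n \<subseteq>
     x ` {i. i < n \<and> \<bar>p (Suc i) \<bullet> p (Suc i) - p i \<bullet> p i\<bar> < (norm (p (Suc i) - p i))\<^sup>2}"
proof -
  define x where "x i = (THE y. y \<in> open_segment (p i) (p (Suc i)) \<and> y \<bullet> (p (Suc i) - p i) = 0)" for i
  have "y = x i \<and> \<bar>p (Suc i) \<bullet> p (Suc i) - p i \<bullet> p i\<bar> < (norm (p (Suc i) - p i))\<^sup>2"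
    if "y \<in> open_segment (p i) (p (Suc i)) \<and> y \<bullet> (p (Suc i) - p i) = 0" for y i
  proof -
    have st: "p i \<bullet> (p (Suc i) - p i) < 0 \<and> 0 < p (Suc i) \<bullet> (p (Suc i) - p i)"
      using that ex1_stable_equilibrium_on_side_iff(2) by blast
    then have "x i = y"
      unfolding x_def using that ex1_stable_equilibrium_on_side_iff(1) by (metis (mono_tags, lifting) the1_equality)
    then show ?thesis using st stable_foot_iff by blast
  qed
  then show ?thesis unfolding stable_equilibria_def by blast
qed

lemma finite_stable_equilibria: "finite (stable_equilibria p n)"
proof -
  obtain x where "stable_equilibria p n \<subseteq>
     x ` {i. i < n \<and> \<bar>p (Suc i) \<bullet> p (Suc i) - p i \<bullet> p i\<bar> < (norm (p (Suc i) - p i))\<^sup>2}"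
    using stable_equilibria_subset_image by blast
  then show ?thesis by (rule finite_subset) simp
qed

text \<open>The summand 2 accounts for the first and the last vertex, about which being an unstable
  equilibrium gives information on one side only.\<close>

lemma num_polygon_equilibria_le:
  "num_polygon_equilibria p n \<le>
     card {i. i < n \<and> \<bar>p (Suc i) \<bullet> p (Suc i) - p i \<bullet> p i\<bar> < (norm (p (Suc i) - p i))\<^sup>2} +
     card {i. 0 < i \<and> i < n \<and> p (Suc i) \<bullet> p (Suc i) - p i \<bullet> p i \<le> (norm (p (Suc i) - p i))\<^sup>2 \<and>
                p (i - 1) \<bullet> p (i - 1) - p i \<bullet> p i \<le> (norm (p (i - 1) - p i))\<^sup>2} + 2"
    (is "_ \<le> card ?S + card ?U + 2")
proof -
  have sub: "closed_segment (p i) (p (Suc i)) \<subseteq> polygon p n" if "i < n" for i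
    using that unfolding polygon_def by blast
  have side: "q \<bullet> q - v \<bullet> v \<le> (norm (q - v))\<^sup>2" if "v \<bullet> (q - v) \<le> 0" for q v :: "real^2"
    using that unfolding power2_norm_eq_inner by (simp add: inner_diff inner_commute)
  have "unstable_equilibria p n \<subseteq> p ` (?U \<union> {0, n})"
  proof
    fix y assume "y \<in> unstable_equilibria p n"
    then obtain i where i: "y = p i" "i \<le> n"
        "\<forall>\<^sub>F y in at (p i) within polygon p n. norm y \<le> norm (p i)"
      unfolding unstable_equilibria_def by blast
    have "i \<in> ?U" if "i \<noteq> 0" "i \<noteq> n"
    proof -
      have "p i \<bullet> (p (Suc i) - p i) \<le> 0" "p i \<bullet> (p (i - 1) - p i) \<le> 0"
        using that i(2) sub[of i] sub[of "i - 1"]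
        by (intro local_max_norm_imp_inner_le_0[OF _ i(3)]; simp add: closed_segment_commute)+
      then show ?thesis using side that i by auto
    qed
    then have "i \<in> ?U \<union> {0, n}" by blast
    then show "y \<in> p ` (?U \<union> {0, n})" unfolding i(1) by (rule imageI)
  qed
  then have "card (unstable_equilibria p n) \<le> card (?U \<union> {0, n})"
    by (rule surj_card_le[rotated]) simp
  also have "\<dots> \<le> card ?U + card {0, n}" by (rule card_Un_le)
  also have "\<dots> \<le> card ?U + 2" by (simp add: card_insert_if)
  finally have U: "card (unstable_equilibria p n) \<le> card ?U + 2" .
  have S: "card (stable_equilibria p n) \<le> card ?S"
    using stable_equilibria_subset_image[of p n] surj_card_le[of ?S] by auto
  show ?thesis
    unfolding num_polygon_equilibria_def polygon_equilibria_def
    using card_Un_le[of "stable_equilibria p n" "unstable_equilibria p n"] U S by linarith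
qed

text \<open>A vertex of maximal norm is an unstable equilibrium: the polygon is contained in the disc through
  it, as a disc contains every segment between two of its points.\<close>

lemma num_polygon_equilibria_pos: "num_polygon_equilibria p n \<ge> 1"
proof -
  define M where "M = Max ((\<lambda>i. norm (p i)) ` {..n})"
  have "M \<in> (\<lambda>i. norm (p i)) ` {..n}" unfolding M_def by (intro Max_in) auto
  then obtain i where i: "i \<le> n" "norm (p i) = M" by auto
  have le: "norm (p j) \<le> M" if "j \<le> n" for j
    unfolding M_def using that by (intro Max_ge) auto
  have "closed_segment (p j) (p (Suc j)) \<subseteq> cball 0 M" if "j < n" for j
    using that le by (intro closed_segment_subset) auto
  then have "polygon p n \<subseteq> cball 0 M" unfolding polygon_def by blast
  then have "\<forall>\<^sub>F y in at (p i) within polygon p n. norm y \<le> norm (p i)"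
    using i by (intro eventually_at_filter[THEN iffD2] always_eventually) (auto simp: subset_iff)
  then have "p i \<in> polygon_equilibria p n"
    using i unfolding polygon_equilibria_def unstable_equilibria_def by blast
  then show ?thesis
    unfolding num_polygon_equilibria_def
    by (metis One_nat_def Suc_leI card_gt_0_iff empty_iff finite_UnI finite_stable_equilibria
        finite_unstable_equilibria polygon_equilibria_def)
qed

text \<open>A monotone projection to the direction \<open>v\<close> separates the stable equilibria of different sides,
  which could coincide if the polygon crossed itself.\<close>

lemma num_polygon_equilibria_ge:
  assumes "i0 + K \<le> n"
    and mono: "\<And>i. i0 \<le> i \<Longrightarrow> i < i0 + K \<Longrightarrow> p i \<bullet> v < p (Suc i) \<bullet> v"
    and st: "\<And>i. i0 \<le> i \<Longrightarrow> i < i0 + K \<Longrightarrow>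
               \<bar>p (Suc i) \<bullet> p (Suc i) - p i \<bullet> p i\<bar> < (norm (p (Suc i) - p i))\<^sup>2"
  shows "K \<le> num_polygon_equilibria p n"
proof -
  have "\<exists>x. x \<in> open_segment (p i) (p (Suc i)) \<and> x \<bullet> (p (Suc i) - p i) = 0"
    if "i0 \<le> i" "i < i0 + K" for i
    using st[OF that] stable_foot_iff ex1_stable_equilibrium_on_side_iff(2) by blast
  then obtain x where x: "x i \<in> open_segment (p i) (p (Suc i))" "x i \<bullet> (p (Suc i) - p i) = 0"
    if "i0 \<le> i" "i < i0 + K" for i by metis
  have between: "p i \<bullet> v < x i \<bullet> v" "x i \<bullet> v < p (Suc i) \<bullet> v" if i: "i0 \<le> i" "i < i0 + K" for i
  proof -
    obtain u where u: "0 < u" "u < 1" "x i = (1 - u) *\<^sub>R p i + u *\<^sub>R p (Suc i)"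
      using x(1)[OF i] unfolding in_segment by blast
    have *: "x i \<bullet> v = p i \<bullet> v + u * (p (Suc i) \<bullet> v - p i \<bullet> v)"
      unfolding u(3) by (simp add: inner_add_left algebra_simps)
    have "0 < u * (p (Suc i) \<bullet> v - p i \<bullet> v)"
      "u * (p (Suc i) \<bullet> v - p i \<bullet> v) < p (Suc i) \<bullet> v - p i \<bullet> v"
      using u mono[OF i] mult_strict_right_mono[of u 1 "p (Suc i) \<bullet> v - p i \<bullet> v"] by auto
    then show "p i \<bullet> v < x i \<bullet> v" "x i \<bullet> v < p (Suc i) \<bullet> v" using * by linarith+
  qed
  have vert: "p i \<bullet> v \<le> p j \<bullet> v" if "i0 \<le> i" "i \<le> j" "j < i0 + K" for i j
    using that(2,3)
  proof (induction j rule: dec_induct)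
    case (step j)
    then show ?case using mono[of j] that(1) by simp
  qed simp
  have less: "x i \<bullet> v < x j \<bullet> v" if "i0 \<le> i" "i < j" "j < i0 + K" for i j
    using between(2)[of i] vert[of "Suc i" j] between(1)[of j] that by simp
  have "inj_on x {i0..<i0 + K}"
    by (rule linorder_inj_onI') (use less in fastforce)
  then have "card (x ` {i0..<i0 + K}) = K" by (simp add: card_image)
  moreover have "x ` {i0..<i0 + K} \<subseteq> polygon_equilibria p n"
    using x assms(1) unfolding polygon_equilibria_def stable_equilibria_def by force
  moreover have "finite (polygon_equilibria p n)"
    unfolding polygon_equilibria_def by (simp add: finite_stable_equilibria finite_unstable_equilibria)
  ultimately show ?thesis unfolding num_polygon_equilibria_def by (metis card_mono)
qed

section \<open>Counting equilibria of the approximating polygon\<close>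

lemma card_grid_points_le:
  fixes a d s e :: real
  assumes "d > 0" "e \<ge> 0" "finite I"
  shows "real (card {i\<in>I. \<bar>a + real i * d - s\<bar> \<le> e}) \<le> 2 * e / d + 1"
proof (cases "{i\<in>I. \<bar>a + real i * d - s\<bar> \<le> e} = {}")
  case True
  then show ?thesis using assms by (simp only: True) simp
next
  case False
  let ?X = "{i\<in>I. \<bar>a + real i * d - s\<bar> \<le> e}"
  have fin: "finite ?X" using assms by simp
  have in': "Min ?X \<in> ?X" "Max ?X \<in> ?X" using False fin Min_in Max_in by blast+
  have "(real (Max ?X) - real (Min ?X)) * d \<le> 2 * e"
    using in' unfolding left_diff_distrib by auto
  then have "real (Max ?X) - real (Min ?X) \<le> 2 * e / d" using assms by (simp add: field_simps)
  moreover have "?X \<subseteq> {Min ?X..Max ?X}" using fin by auto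
  then have "card ?X \<le> Suc (Max ?X) - Min ?X" using card_mono[of "{Min ?X..Max ?X}" ?X] by simp
  moreover have "Min ?X \<le> Max ?X" using in' fin by auto
  ultimately show ?thesis by (simp add: of_nat_diff)
qed

lemma mean_value_within_closed_interval:
  fixes f f' :: "real \<Rightarrow> real"
  assumes "\<And>x. x \<in> S \<Longrightarrow> (f has_real_derivative f' x) (at x within S)" "{s..t} \<subseteq> S" "s \<le> t"
  obtains \<xi> where "\<xi> \<in> {s..t}" "f t - f s = f' \<xi> * (t - s)"
proof -
  have "\<exists>\<xi>\<in>{s..t}. f t - f s = f' \<xi> * (t - s)"
  proof (rule mvt_very_simple[OF assms(3)])
    fix x assume "s \<le> x" "x \<le> t"
    then show "(f has_derivative (*) (f' x)) (at x within {s..t})"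
      using assms(1)[of x] assms(2) has_derivative_subset[OF _ assms(2), of f "(*) (f' x)" x] \<open>s \<le> x\<close> \<open>x \<le> t\<close>
      by (auto simp: has_field_derivative_def)
  qed
  then show thesis using that by blast
qed

text \<open>An equilibrium of the polygon at the side or inner vertex with index \<open>i\<close> forces \<open>|f'| \<le> L^2 * d\<close>
  at a parameter within \<open>d\<close> of the \<open>i\<close>-th division point. By the lower bound on \<open>|f'|\<close> that
  parameter is within \<open>(L^2 * d / c) powr (1 / m)\<close> of a centre. This leaves an interval for each
  centre, which is counted twice, for stable and for unstable equilibria.\<close>

lemma num_approx_equilibria_le:
  fixes r :: "real \<Rightarrow> real^2" and a b c L :: real and f' :: "real \<Rightarrow> real"
  assumes ab: "a < b" and n: "n \<ge> 1"
    and f': "\<And>t. t \<in> {a..b} \<Longrightarrow> ((\<lambda>t. r t \<bullet> r t) has_real_derivative f' t) (at t within {a..b})"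
    and cont: "continuous_on {a..b} f'"
    and lip: "\<And>s t. s \<in> {a..b} \<Longrightarrow> t \<in> {a..b} \<Longrightarrow> norm (r t - r s) \<le> L * \<bar>t - s\<bar>"
    and F: "finite F" "c > 0" "m \<ge> 1"
      "\<And>t. t \<in> {a..b} \<Longrightarrow> \<exists>s\<in>F. c * dist s t ^ m \<le> \<bar>f' t\<bar>"
  defines "d \<equiv> mesh a b n"
  shows "real (num_polygon_equilibria (approx_vertex r a b n) n) \<le>
           2 * real (card F) * (2 * (d + (L\<^sup>2 * d / c) powr (1 / real m)) / d + 1) + 2"
proof -
  let ?p = "approx_vertex r a b n"
  define \<tau> where "\<tau> i = a + real i * d" for i
  define e where "e = d + (L\<^sup>2 * d / c) powr (1 / real m)"
  have d: "d > 0" using ab n by (simp add: d_def mesh_def)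
  have p: "?p i = r (\<tau> i)" for i by (simp add: approx_vertex_def \<tau>_def d_def)
  have dn: "real n * d = b - a" using n by (simp add: d_def mesh_def)
  have \<tau>: "\<tau> i \<in> {a..b}" if "i \<le> n" for i
    using mult_right_mono[of "real i" "real n" d] that d dn by (auto simp: \<tau>_def)
  have \<tau>_Suc: "\<tau> (Suc i) = \<tau> i + d" for i by (simp add: \<tau>_def algebra_simps)
  have side: "(norm (r t - r s))\<^sup>2 \<le> L\<^sup>2 * d\<^sup>2"
    if "s \<in> {a..b}" "t \<in> {a..b}" "\<bar>t - s\<bar> = d" for s t
    using power_mono[OF lip[OF that(1,2)], of 2] that(3) by (simp add: power_mult_distrib)
  have mvt: "\<exists>\<xi>\<in>{s..t}. r t \<bullet> r t - r s \<bullet> r s = f' \<xi> * (t - s)"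
    if "s \<in> {a..b}" "t \<in> {a..b}" "s \<le> t" for s t
    by (rule mean_value_within_closed_interval[OF f', of s t]) (use that in auto)
  define I where "I = {i\<in>{..n}. \<exists>\<xi>\<in>{a..b}. \<bar>\<xi> - \<tau> i\<bar> \<le> d \<and> \<bar>f' \<xi>\<bar> \<le> L\<^sup>2 * d}"
  have stable: "{i. i < n \<and> \<bar>?p (Suc i) \<bullet> ?p (Suc i) - ?p i \<bullet> ?p i\<bar> < (norm (?p (Suc i) - ?p i))\<^sup>2} \<subseteq> I"
  proof (rule subsetI, elim CollectE conjE)
    fix i assume i: "i < n" "\<bar>?p (Suc i) \<bullet> ?p (Suc i) - ?p i \<bullet> ?p i\<bar> < (norm (?p (Suc i) - ?p i))\<^sup>2"
    have in': "\<tau> i \<in> {a..b}" "\<tau> (Suc i) \<in> {a..b}" using \<tau> i by auto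
    obtain \<xi> where \<xi>: "\<xi> \<in> {\<tau> i..\<tau> (Suc i)}"
        "r (\<tau> (Suc i)) \<bullet> r (\<tau> (Suc i)) - r (\<tau> i) \<bullet> r (\<tau> i) = f' \<xi> * d"
      using mvt[OF in'] d by (auto simp: \<tau>_Suc)
    have "\<bar>f' \<xi> * d\<bar> \<le> L\<^sup>2 * d\<^sup>2"
      using i(2) side[OF in'] d \<xi>(2) by (simp add: p \<tau>_Suc)
    then have "\<bar>f' \<xi>\<bar> \<le> L\<^sup>2 * d" using d by (simp add: abs_mult power2_eq_square)
    then show "i \<in> I" using \<xi>(1) in' i by (auto simp: I_def \<tau>_Suc intro!: bexI[of _ \<xi>])
  qed
  have unstable: "{i. 0 < i \<and> i < n \<and> ?p (Suc i) \<bullet> ?p (Suc i) - ?p i \<bullet> ?p i \<le> (norm (?p (Suc i) - ?p i))\<^sup>2 \<and>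
                ?p (i - 1) \<bullet> ?p (i - 1) - ?p i \<bullet> ?p i \<le> (norm (?p (i - 1) - ?p i))\<^sup>2} \<subseteq> I"
  proof (rule subsetI, elim CollectE conjE)
    fix i assume i: "0 < i" "i < n" "?p (Suc i) \<bullet> ?p (Suc i) - ?p i \<bullet> ?p i \<le> (norm (?p (Suc i) - ?p i))\<^sup>2"
      "?p (i - 1) \<bullet> ?p (i - 1) - ?p i \<bullet> ?p i \<le> (norm (?p (i - 1) - ?p i))\<^sup>2"
    have in': "\<tau> i \<in> {a..b}" "\<tau> (Suc i) \<in> {a..b}" "\<tau> (i - 1) \<in> {a..b}" using \<tau> i by auto
    have pred: "\<tau> i = \<tau> (i - 1) + d" using \<tau>_Suc[of "i - 1"] i(1) by simp
    obtain \<xi> where \<xi>: "\<xi> \<in> {\<tau> i..\<tau> (Suc i)}"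
        "r (\<tau> (Suc i)) \<bullet> r (\<tau> (Suc i)) - r (\<tau> i) \<bullet> r (\<tau> i) = f' \<xi> * d"
      using mvt[OF in'(1,2)] d by (auto simp: \<tau>_Suc)
    obtain \<zeta> where \<zeta>: "\<zeta> \<in> {\<tau> (i - 1)..\<tau> i}"
        "r (\<tau> i) \<bullet> r (\<tau> i) - r (\<tau> (i - 1)) \<bullet> r (\<tau> (i - 1)) = f' \<zeta> * d"
      using mvt[OF in'(3,1)] d by (auto simp: pred)
    have "f' \<xi> * d \<le> L\<^sup>2 * d\<^sup>2" using i(3) side[OF in'(1,2)] d \<xi>(2) by (simp add: p \<tau>_Suc)
    then have up: "f' \<xi> \<le> L\<^sup>2 * d" using d by (simp add: power2_eq_square)
    have "- f' \<zeta> * d \<le> L\<^sup>2 * d * d" using i(4) side[OF in'(1,3)] d \<zeta>(2) by (simp add: p pred power2_eq_square mult.assoc)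
    then have lo: "- f' \<zeta> \<le> L\<^sup>2 * d" using d by (rule mult_right_le_imp_le)
    have Ld: "0 \<le> L\<^sup>2 * d" using d by simp
    \<comment> \<open>If \<open>|f'|\<close> is large at both points, then \<open>f'\<close> is positive at \<open>\<zeta>\<close> and negative at \<open>\<xi>\<close>.\<close>
    have "\<exists>x\<in>{\<zeta>..\<xi>}. \<bar>f' x\<bar> \<le> L\<^sup>2 * d"
    proof (cases "\<bar>f' \<xi>\<bar> \<le> L\<^sup>2 * d \<or> \<bar>f' \<zeta>\<bar> \<le> L\<^sup>2 * d")
      case True
      then show ?thesis using \<xi>(1) \<zeta>(1) by force
    next
      case False
      then have "f' \<xi> \<le> 0" "0 \<le> f' \<zeta>" using up lo Ld by linarith+
      moreover have "continuous_on {\<zeta>..\<xi>} f'"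
        by (rule continuous_on_subset[OF cont]) (use \<xi>(1) \<zeta>(1) in' in auto)
      ultimately obtain x where "\<zeta> \<le> x" "x \<le> \<xi>" "f' x = 0"
        using IVT2'[of f' \<xi> 0 \<zeta>] \<xi>(1) \<zeta>(1) by auto
      then show ?thesis using Ld by (intro bexI[of _ x]) auto
    qed
    then obtain x where "x \<in> {\<zeta>..\<xi>}" "\<bar>f' x\<bar> \<le> L\<^sup>2 * d" by blast
    moreover from this have "x \<in> {a..b}" "\<bar>x - \<tau> i\<bar> \<le> d"
      using \<xi>(1) \<zeta>(1) in' pred \<tau>_Suc[of i] unfolding atLeastAtMost_iff by linarith+
    ultimately show "i \<in> I" using i(2) unfolding I_def by auto
  qed
  have "I \<subseteq> (\<Union>s\<in>F. {i\<in>{..n}. \<bar>a + real i * d - s\<bar> \<le> e})"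
  proof
    fix i assume "i \<in> I"
    then obtain \<xi> where \<xi>: "\<xi> \<in> {a..b}" "\<bar>\<xi> - \<tau> i\<bar> \<le> d" "\<bar>f' \<xi>\<bar> \<le> L\<^sup>2 * d" and "i \<le> n"
      unfolding I_def by blast
    obtain s where s: "s \<in> F" "c * dist s \<xi> ^ m \<le> \<bar>f' \<xi>\<bar>" using F(4) \<xi>(1) by blast
    have pw: "dist s \<xi> ^ m \<le> L\<^sup>2 * d / c" using s(2) \<xi>(3) F(2) by (simp add: field_simps)
    have "dist s \<xi> \<le> (L\<^sup>2 * d / c) powr (1 / real m)"
    proof (cases "dist s \<xi> = 0")
      case False
      then have pos: "dist s \<xi> > 0" by simp
      have "dist s \<xi> = (dist s \<xi> ^ m) powr (1 / real m)"
        using F(3) pos by (simp add: powr_realpow[symmetric] powr_powr)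
      also have "\<dots> \<le> (L\<^sup>2 * d / c) powr (1 / real m)"
        using pw by (intro powr_mono2) auto
      finally show ?thesis .
    qed simp
    then have "\<bar>\<tau> i - s\<bar> \<le> e" using \<xi>(2) unfolding e_def dist_real_def by linarith
    then show "i \<in> (\<Union>s\<in>F. {i\<in>{..n}. \<bar>a + real i * d - s\<bar> \<le> e})"
      using s(1) \<open>i \<le> n\<close> by (auto simp: \<tau>_def)
  qed
  then have "card I \<le> card (\<Union>s\<in>F. {i\<in>{..n}. \<bar>a + real i * d - s\<bar> \<le> e})"
    by (intro card_mono) (use F(1) in auto)
  also have "\<dots> \<le> (\<Sum>s\<in>F. card {i\<in>{..n}. \<bar>a + real i * d - s\<bar> \<le> e})"
    by (rule card_UN_le[OF F(1)])
  finally have "real (card I) \<le> (\<Sum>s\<in>F. real (card {i\<in>{..n}. \<bar>a + real i * d - s\<bar> \<le> e}))"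
    by (simp only: of_nat_sum[symmetric] of_nat_le_iff)
  also have "\<dots> \<le> (\<Sum>s\<in>F. 2 * e / d + 1)"
    by (intro sum_mono card_grid_points_le) (use d in \<open>auto simp: e_def\<close>)
  finally have cardI: "real (card I) \<le> real (card F) * (2 * e / d + 1)" by simp
  have finI: "finite I" by (simp add: I_def)
  have "num_polygon_equilibria ?p n \<le> card I + card I + 2"
    using num_polygon_equilibria_le[of ?p n] card_mono[OF finI stable] card_mono[OF finI unstable]
    by linarith
  then have "real (num_polygon_equilibria ?p n) \<le> 2 * real (card I) + 2" by linarith
  also have "\<dots> \<le> 2 * real (card F) * (2 * e / d + 1) + 2"
    using cardI unfolding mult.assoc by linarith
  finally show ?thesis unfolding e_def .
qed

text \<open>Every side with parameters in \<open>{0..e}\<close> carries a stable equilibrium, because the increment of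
  \<open>|r|^2\<close> along it is at most \<open>C * d\<close>, which is less than \<open>(\<mu> * d)^2\<close>, while its length is at
  least \<open>\<mu> * d\<close>. At least \<open>e / d - 2\<close> sides fit into that interval.\<close>

lemma num_approx_equilibria_ge:
  fixes r :: "real \<Rightarrow> real^2" and a b C \<mu> e :: real and f' :: "real \<Rightarrow> real"
  assumes ab: "a < 0" "0 < b" and n: "n \<ge> 1"
    and f': "\<And>t. t \<in> {a..b} \<Longrightarrow> ((\<lambda>t. r t \<bullet> r t) has_real_derivative f' t) (at t within {a..b})"
    and e: "0 \<le> e" "e \<le> b"
    and small: "\<And>t. 0 \<le> t \<Longrightarrow> t \<le> e \<Longrightarrow> \<bar>f' t\<bar> \<le> C"
    and dir: "\<And>s t. 0 \<le> s \<Longrightarrow> s < t \<Longrightarrow> t \<le> e \<Longrightarrow> \<mu> * (t - s) \<le> (r t - r s) \<bullet> v"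
    and \<mu>: "\<mu> > 0" "norm v = 1"
  defines "d \<equiv> mesh a b n"
  assumes C: "C < \<mu>\<^sup>2 * d"
  shows "e / d - 2 \<le> real (num_polygon_equilibria (approx_vertex r a b n) n)"
proof (cases "e / d - 2 \<le> 0")
  case False
  let ?p = "approx_vertex r a b n"
  define \<tau> where "\<tau> i = a + real i * d" for i
  have d: "d > 0" using ab n by (simp add: d_def mesh_def)
  have p: "?p i = r (\<tau> i)" for i by (simp add: approx_vertex_def \<tau>_def d_def)
  have dn: "real n * d = b - a" using n by (simp add: d_def mesh_def)
  have \<tau>_Suc: "\<tau> (Suc i) = \<tau> i + d" for i by (simp add: \<tau>_def algebra_simps)
  \<comment> \<open>Vertex \<open>i0\<close> is the first with nonnegative parameter; then \<open>i0 + K\<close> has parameter at most \<open>e\<close>.\<close>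
  define i0 where "i0 = nat \<lceil>- a / d\<rceil>"
  define K where "K = nat (\<lfloor>e / d\<rfloor> - 1)"
  have i0: "- a / d \<le> real i0" "real i0 < - a / d + 1"
  proof -
    have "0 \<le> - a / d" using ab d by (intro divide_nonneg_pos) auto
    then show "- a / d \<le> real i0" "real i0 < - a / d + 1" unfolding i0_def by linarith+
  qed
  have K: "e / d - 2 \<le> real K" "real K \<le> e / d - 1"
    using False unfolding K_def by linarith+
  have "- a \<le> real i0 * d" using i0(1) d by (simp add: field_simps)
  then have lo: "0 \<le> \<tau> i" if "i0 \<le> i" for i
  proof -
    have "real i0 * d \<le> real i * d" using that d by (intro mult_right_mono) auto
    then show ?thesis using \<open>- a \<le> real i0 * d\<close> by (simp add: \<tau>_def)
  qed
  have "real (i0 + K) \<le> (e - a) / d" using i0(2) K(2) by (simp add: diff_divide_distrib)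
  then have "real (i0 + K) * d \<le> e - a" using d by (simp add: field_simps)
  then have hi: "\<tau> i \<le> e" if "i \<le> i0 + K" for i
  proof -
    have "real i * d \<le> real (i0 + K) * d" using that d by (intro mult_right_mono) auto
    then show ?thesis using \<open>real (i0 + K) * d \<le> e - a\<close> by (simp add: \<tau>_def)
  qed
  have len: "i0 + K \<le> n"
  proof -
    have "real (i0 + K) * d \<le> real n * d"
      using \<open>real (i0 + K) * d \<le> e - a\<close> e dn by linarith
    then show ?thesis using d by simp
  qed
  have step: "\<mu> * d \<le> (?p (Suc i) - ?p i) \<bullet> v" if "i0 \<le> i" "i < i0 + K" for i
    using dir[of "\<tau> i" "\<tau> (Suc i)"] lo[of i] hi[of "Suc i"] that d by (simp add: p \<tau>_Suc)
  have "K \<le> num_polygon_equilibria ?p n"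
  proof (rule num_polygon_equilibria_ge[OF len])
    fix i assume i: "i0 \<le> i" "i < i0 + K"
    have pos: "0 < \<mu> * d" using \<mu> d by simp
    then show "?p i \<bullet> v < ?p (Suc i) \<bullet> v" using step[OF i] by (simp add: inner_diff_left)
    have "\<mu> * d \<le> norm (?p (Suc i) - ?p i)"
      using step[OF i] norm_cauchy_schwarz[of "?p (Suc i) - ?p i" v] \<mu> by simp
    then have long: "(\<mu> * d)\<^sup>2 \<le> (norm (?p (Suc i) - ?p i))\<^sup>2" using pos by (intro power_mono) auto
    have in': "0 \<le> \<tau> i" "\<tau> i \<le> \<tau> (Suc i)" "\<tau> (Suc i) \<le> e"
      using lo[of i] hi[of "Suc i"] i d by (auto simp: \<tau>_Suc)
    obtain \<xi> where \<xi>: "\<xi> \<in> {\<tau> i..\<tau> (Suc i)}"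
        "r (\<tau> (Suc i)) \<bullet> r (\<tau> (Suc i)) - r (\<tau> i) \<bullet> r (\<tau> i) = f' \<xi> * (\<tau> (Suc i) - \<tau> i)"
      by (rule mean_value_within_closed_interval[OF f', of "\<tau> i" "\<tau> (Suc i)"])
        (use in' ab e in auto)
    have "\<bar>f' \<xi> * d\<bar> \<le> C * d"
      using small[of \<xi>] \<xi>(1) in' d by (simp add: abs_mult)
    also have "\<dots> < (\<mu> * d)\<^sup>2" using C d by (simp add: power2_eq_square mult.assoc)
    also note long
    finally show "\<bar>?p (Suc i) \<bullet> ?p (Suc i) - ?p i \<bullet> ?p i\<bar> < (norm (?p (Suc i) - ?p i))\<^sup>2"
      using \<xi>(2) by (simp add: p \<tau>_Suc)
  qed
  then show ?thesis using K(1) by linarith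
qed simp

section \<open>The asymptotic number of equilibria\<close>

lemma C1_imp_lipschitz:
  fixes r :: "real \<Rightarrow> 'a::real_normed_vector"
  assumes r: "\<And>t. t \<in> {a..b} \<Longrightarrow> (r has_vector_derivative r' t) (at t within {a..b})"
    and "continuous_on {a..b} r'"
  obtains L where "\<And>s t. s \<in> {a..b} \<Longrightarrow> t \<in> {a..b} \<Longrightarrow> norm (r t - r s) \<le> L * \<bar>t - s\<bar>"
proof -
  have "bounded (r' ` {a..b})"
    by (intro compact_imp_bounded compact_continuous_image assms(2)) simp
  then obtain L where L: "\<And>t. t \<in> {a..b} \<Longrightarrow> norm (r' t) \<le> L"
    unfolding bounded_iff by blast
  have "norm (r t - r s) \<le> L * norm (t - s)" if "s \<in> {a..b}" "t \<in> {a..b}" for s t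
  proof (rule differentiable_bound[OF convex_real_interval(5) _ _ that(2,1)])
    fix x assume x: "x \<in> {a..b}"
    show "(r has_derivative (\<lambda>h. h *\<^sub>R r' x)) (at x within {a..b})"
      using r[OF x] by (simp add: has_vector_derivative_def)
    show "onorm (\<lambda>h. h *\<^sub>R r' x) \<le> L"
    proof (rule onorm_le)
      show "norm (h *\<^sub>R r' x) \<le> L * norm h" for h
        using mult_right_mono[OF L[OF x], of "norm h"] by (simp add: mult.commute)
    qed
  qed
  then show thesis using that by auto
qed

text \<open>By continuity \<open>r' t\<close> keeps a component of at least \<open>|r' t0| / 2\<close> along the unit tangent vector at
  \<open>t0\<close>.\<close>

lemma C1_regular_increasing_in_tangent_direction:
  fixes r r' :: "real \<Rightarrow> 'a::real_inner"
  assumes r: "\<And>t. t \<in> {a..b} \<Longrightarrow> (r has_vector_derivative r' t) (at t within {a..b})"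
    and cont: "continuous_on {a..b} r'" and "t0 \<in> {a..b}" "r' t0 \<noteq> 0"
  obtains v \<mu> \<epsilon> where "norm v = 1" "\<mu> > 0" "\<epsilon> > 0"
    "\<And>s t. s \<in> {a..b} \<Longrightarrow> t \<in> {a..b} \<Longrightarrow> t0 - \<epsilon> < s \<Longrightarrow> s < t \<Longrightarrow> t < t0 + \<epsilon> \<Longrightarrow>
       \<mu> * (t - s) \<le> (r t - r s) \<bullet> v"
proof -
  define N where "N = norm (r' t0)"
  define v where "v = r' t0 /\<^sub>R N"
  have N: "N > 0" using assms(4) by (simp add: N_def)
  have v: "norm v = 1" using N by (simp add: v_def N_def)
  have v0: "r' t0 \<bullet> v = N"
    using N by (simp add: v_def N_def power2_norm_eq_inner[symmetric] power2_eq_square)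
  obtain \<epsilon> where \<epsilon>: "\<epsilon> > 0" "\<And>t. t \<in> {a..b} \<Longrightarrow> dist t t0 < \<epsilon> \<Longrightarrow> dist (r' t) (r' t0) < N / 2"
    using cont assms(3) N unfolding continuous_on_iff by (metis half_gt_zero)
  show thesis
  proof (rule that[OF v half_gt_zero[OF N] \<epsilon>(1)])
    fix s t assume st: "s \<in> {a..b}" "t \<in> {a..b}" "t0 - \<epsilon> < s" "s < t" "t < t0 + \<epsilon>"
    have "((\<lambda>t. r t \<bullet> v) has_real_derivative r' x \<bullet> v) (at x within {a..b})" if "x \<in> {a..b}" for x
      using bounded_linear.has_vector_derivative[OF bounded_linear_inner_left r[OF that]]
      by (simp add: has_real_derivative_iff_has_vector_derivative)
    then obtain \<xi> where \<xi>: "\<xi> \<in> {s..t}" "r t \<bullet> v - r s \<bullet> v = (r' \<xi> \<bullet> v) * (t - s)"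
      by (rule mean_value_within_closed_interval[of "{a..b}" _ _ s t]) (use st in auto)
    have "norm (r' \<xi> - r' t0) < N / 2"
      using \<epsilon>(2)[of \<xi>] \<xi>(1) st by (auto simp: dist_norm)
    then have "\<bar>(r' \<xi> - r' t0) \<bullet> v\<bar> \<le> N / 2"
      using Cauchy_Schwarz_ineq2[of "r' \<xi> - r' t0" v] v by simp
    then have "N / 2 \<le> r' \<xi> \<bullet> v" using v0 by (simp add: inner_diff_left abs_if split: if_splits)
    then show "N / 2 * (t - s) \<le> (r t - r s) \<bullet> v"
      using st \<xi>(2) by (simp add: inner_diff_left mult_right_mono)
  qed
qed

lemma powr_inverse_power:
  fixes x :: real
  assumes "x > 0" "m \<ge> 1"
  shows "(x powr (1 / real m)) ^ m = x"
proof -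
  have "(x powr (1 / real m)) ^ m = (x powr (1 / real m)) powr real m"
    by (rule powr_realpow[symmetric]) (use assms in simp)
  then show ?thesis using assms by (simp add: powr_powr)
qed

theorem theorem4:
  fixes r :: "real \<Rightarrow> real^2" and a b :: real and k :: nat
  assumes "a < 0" and "0 < b"
    and "k \<ge> 2"
    and "C_class_on (2 * k - 1) {a..b} r"
    and "regular_on {a..b} r"
    and "convex_curve_on {a..b} r"
    and "r 0 \<noteq> 0"
    and "\<forall>t. curve_equilibrium {a..b} r t \<longleftrightarrow> t = 0"
    and "locally_convex_wrt_origin r 0"
    and "first_nonzero_deriv_order (\<lambda>t. norm (r t)) 0 k"
  shows "\<exists>C1 C2 :: real. C1 > 0 \<and> C2 > 0 \<and>
    (\<forall>n\<ge>1. generic_polygon (approx_vertex r a b n) n \<longrightarrow>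
       C1 * mesh a b n powr (- ((real k - 2) / (real k - 1)))
         \<le> real (num_polygon_equilibria (approx_vertex r a b n) n) \<and>
       real (num_polygon_equilibria (approx_vertex r a b n) n)
         \<le> C2 * mesh a b n powr (- ((real k - 2) / (real k - 1))))"
proof -
  let ?S = "{a..b}"
  let ?N = "\<lambda>n. real (num_polygon_equilibria (approx_vertex r a b n) n)"
  define m where "m = k - 1"
  define \<alpha> where "\<alpha> = 1 / real m"
  define \<theta> where "\<theta> = (real k - 2) / (real k - 1)"
  have m: "m \<ge> 1" using assms(3) by (simp add: m_def)
  have \<alpha>: "0 < \<alpha>" using m by (simp add: \<alpha>_def)
  have \<theta>: "\<theta> = 1 - \<alpha>" "0 \<le> \<theta>"
    using assms(3) by (auto simp: \<theta>_def \<alpha>_def m_def of_nat_diff field_simps)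
  have ab: "a < b" and in0: "0 \<in> ?S" using assms(1,2) by auto

  have "C_class_on (Suc (Suc 0)) ?S r"
    by (rule C_class_on_mono[OF assms(4)]) (use assms(3) in auto)
  then obtain r' r'' where r: "\<And>t. t \<in> ?S \<Longrightarrow> (r has_vector_derivative r' t) (at t within ?S)"
      and r': "\<And>t. t \<in> ?S \<Longrightarrow> (r' has_vector_derivative r'' t) (at t within ?S)"
    by (metis C_class_on_SucE)
  have cont_r': "continuous_on ?S r'"
    by (rule continuous_on_vector_derivative[OF r'])
  have cont_r: "continuous_on ?S r"
    by (rule continuous_on_vector_derivative[OF r])
  have reg: "r' t \<noteq> 0" if "t \<in> ?S" for t
  proof -
    have "vector_derivative r (at t within ?S) = r' t"
      using vector_derivative_within_closed_interval[OF ab that r[OF that]] .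
    then show ?thesis using assms(5) that unfolding regular_on_def by metis
  qed
  define f' where "f' t = 2 * (r t \<bullet> r' t)" for t
  have f': "((\<lambda>t. r t \<bullet> r t) has_real_derivative f' t) (at t within ?S)" if "t \<in> ?S" for t
    using bounded_bilinear.has_vector_derivative[OF bounded_bilinear_inner r[OF that] r[OF that]]
    by (simp add: has_real_derivative_iff_has_vector_derivative f'_def inner_commute)
  have cont_f': "continuous_on ?S f'"
    unfolding f'_def by (intro continuous_intros cont_r cont_r')

  have "C_class_on k ?S r" by (rule C_class_on_mono[OF assms(4)]) (use assms(3) in auto)
  from inner_deriv_bounds_at_critical_point[OF assms(1,2) r assms(7) this assms(10)]
  obtain c0 C \<delta> where c0: "c0 > 0" "C > 0" "\<delta> > 0" "\<delta> \<le> - a" "\<delta> \<le> b"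
    "\<And>t. \<bar>t\<bar> \<le> \<delta> \<Longrightarrow> c0 * \<bar>t\<bar> ^ m \<le> \<bar>r t \<bullet> r' t\<bar>"
    "\<And>t. \<bar>t\<bar> \<le> \<delta> \<Longrightarrow> \<bar>r t \<bullet> r' t\<bar> \<le> C * \<bar>t\<bar> ^ m"
    unfolding m_def by blast

  have "\<exists>c>0. \<exists>\<delta>>0. \<forall>t\<in>?S. dist s t < \<delta> \<longrightarrow> c * dist s t ^ m \<le> \<bar>r t \<bullet> r' t\<bar>" if "s \<in> ?S" for s
  proof (rule inner_deriv_lower_bound_local[OF r r' reg _ c0(1,3) _ m that])
    show "t = 0" if "t \<in> ?S" "((\<lambda>t. norm (r t)) has_real_derivative 0) (at t within ?S)" for t
      using assms(8) that unfolding curve_equilibrium_def by blast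
    show "c0 * dist 0 t ^ m \<le> \<bar>r t \<bullet> r' t\<bar>" if "dist 0 t < \<delta>" for t
      using c0(6)[of t] that by (simp add: dist_real_def)
  qed
  then obtain F c where F: "finite F" "c > 0"
      and Fc: "\<And>t. t \<in> ?S \<Longrightarrow> \<exists>s\<in>F. c * dist s t ^ m \<le> \<bar>r t \<bullet> r' t\<bar>"
    using compact_finite_centres[OF compact_Icc, of a b m "\<lambda>t. \<bar>r t \<bullet> r' t\<bar>"] by blast
  have F': "\<exists>s\<in>F. c * dist s t ^ m \<le> \<bar>f' t\<bar>" if "t \<in> ?S" for t
  proof -
    obtain s where "s \<in> F" "c * dist s t ^ m \<le> \<bar>r t \<bullet> r' t\<bar>" using Fc[OF \<open>t \<in> ?S\<close>] by blast
    moreover have "\<bar>r t \<bullet> r' t\<bar> \<le> \<bar>f' t\<bar>" by (simp add: f'_def)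
    ultimately show ?thesis by (meson order_trans)
  qed
  obtain L where L: "\<And>s t. s \<in> ?S \<Longrightarrow> t \<in> ?S \<Longrightarrow> norm (r t - r s) \<le> L * \<bar>t - s\<bar>"
    using C1_imp_lipschitz[OF r cont_r'] by blast

  obtain v \<mu> \<epsilon> where v: "norm v = 1" "\<mu> > 0" "\<epsilon> > 0"
    and dir: "\<And>s t. s \<in> ?S \<Longrightarrow> t \<in> ?S \<Longrightarrow> 0 - \<epsilon> < s \<Longrightarrow> s < t \<Longrightarrow> t < 0 + \<epsilon> \<Longrightarrow>
       \<mu> * (t - s) \<le> (r t - r s) \<bullet> v"
    using C1_regular_increasing_in_tangent_direction[OF r cont_r' in0 reg[OF in0]] by blast
  define \<epsilon>' where "\<epsilon>' = min \<delta> (\<epsilon> / 2)"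
  have \<epsilon>': "0 < \<epsilon>'" "\<epsilon>' \<le> \<delta>" "\<epsilon>' < \<epsilon>" using c0 v by (auto simp: \<epsilon>'_def)

  \<comment> \<open>The window is \<open>{0..e}\<close> with \<open>e = q * d powr \<alpha>\<close>. The first bound on \<open>q\<close> makes the increments of
    \<open>|r|^2\<close> small compared with \<open>\<mu>\<^sup>2 * d\<^sup>2\<close>; the second keeps \<open>e \<le> \<epsilon>'\<close>, because \<open>d \<le> b - a\<close>.\<close>
  define q where "q = min ((\<mu>\<^sup>2 / (4 * C)) powr \<alpha>) (\<epsilon>' / (b - a) powr \<alpha>)"
  have q: "q > 0" using v c0 \<epsilon>' ab by (simp add: q_def)
  have "q ^ m \<le> ((\<mu>\<^sup>2 / (4 * C)) powr \<alpha>) ^ m" using q by (intro power_mono) (auto simp: q_def)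
  also have "\<dots> = \<mu>\<^sup>2 / (4 * C)"
    unfolding \<alpha>_def using v c0 m by (intro powr_inverse_power) auto
  finally have "4 * (C * q ^ m) \<le> \<mu>\<^sup>2" using c0 by (simp add: field_simps)
  moreover have "0 < \<mu>\<^sup>2" using v(2) by simp
  ultimately have qm: "2 * C * q ^ m < \<mu>\<^sup>2" unfolding mult.assoc by linarith
  \<comment> \<open>As \<open>d \<le> b - a\<close>, additive constants are absorbed by \<open>1 \<le> B * d powr (- \<theta>)\<close>.\<close>
  define B where "B = (b - a) powr \<theta>"
  define M where "M = (L\<^sup>2 / c) powr \<alpha>"
  have B: "B > 0" using ab by (simp add: B_def)
  have M: "M \<ge> 0" by (simp add: M_def)
  define C2 where "C2 = 2 * real (card F) * (3 * B + 2 * M) + 2 * B"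
  have "C2 > 0" unfolding C2_def using B M by (intro add_nonneg_pos mult_nonneg_nonneg) auto

  have main: "q / 3 * mesh a b n powr (- \<theta>) \<le> ?N n \<and> ?N n \<le> C2 * mesh a b n powr (- \<theta>)"
    if n: "n \<ge> 1" for n
  proof
    define d where "d = mesh a b n"
    have d: "d > 0" using ab n by (simp add: d_def mesh_def)
    have dle: "d \<le> b - a"
      using ab n by (simp add: d_def mesh_def divide_le_eq mult_le_cancel_left1)
    have powr_div: "d powr \<alpha> / d = d powr (- \<theta>)"
      using d by (simp add: \<theta> powr_diff)
    define e where "e = q * d powr \<alpha>"
    have e0: "0 \<le> e" using q by (simp add: e_def)
    have "e \<le> \<epsilon>' / (b - a) powr \<alpha> * (b - a) powr \<alpha>"
      unfolding e_def using d dle \<alpha> \<epsilon>' by (intro mult_mono powr_mono2) (auto simp: q_def)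
    then have e1: "e \<le> \<epsilon>'" using ab by simp
    have em: "e ^ m = q ^ m * d"
      using powr_inverse_power[OF d m] by (simp add: e_def power_mult_distrib \<alpha>_def)
    have "e / d - 2 \<le> ?N n"
      unfolding d_def
    proof (rule num_approx_equilibria_ge[OF assms(1,2) n f' e0 _ _ _ v(2,1)])
      show "e \<le> b" using e1 \<epsilon>' c0 by linarith
      show "\<bar>f' t\<bar> \<le> 2 * C * e ^ m" if "0 \<le> t" "t \<le> e" for t
      proof -
        have "\<bar>r t \<bullet> r' t\<bar> \<le> C * \<bar>t\<bar> ^ m" using c0(7)[of t] that e1 \<epsilon>' by simp
        also have "\<dots> \<le> C * e ^ m"
          using that c0 by (intro mult_left_mono power_mono) auto
        finally show ?thesis by (simp add: f'_def abs_mult)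
      qed
      show "\<mu> * (t - s) \<le> (r t - r s) \<bullet> v" if "0 \<le> s" "s < t" "t \<le> e" for s t
        by (rule dir) (use that e1 \<epsilon>' c0 assms(1) in auto)
      show "2 * C * e ^ m < \<mu>\<^sup>2 * mesh a b n"
        using mult_strict_right_mono[OF qm d] unfolding em by (simp add: d_def mult.assoc)
    qed
    moreover have "1 \<le> ?N n" using num_polygon_equilibria_pos[of "approx_vertex r a b n" n] by linarith
    \<comment> \<open>Where \<open>e / d - 2\<close> is small or negative, the equilibrium that always exists suffices.\<close>
    moreover have "x / 3 \<le> y" if "x - 2 \<le> y" "1 \<le> y" for x y :: real using that by linarith
    ultimately have third: "e / d / 3 \<le> ?N n" by blast
    show "q / 3 * mesh a b n powr (- \<theta>) \<le> ?N n"
    proof -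
      have "e / d = q * (d powr \<alpha> / d)" by (simp add: e_def)
      then show ?thesis using third unfolding powr_div by (simp add: d_def)
    qed
    have "d powr \<theta> \<le> B" unfolding B_def using d dle \<theta> by (intro powr_mono2) auto
    then have one: "1 \<le> B * d powr (- \<theta>)" using d by (simp add: powr_minus field_simps)
    have "(L\<^sup>2 * d / c) powr \<alpha> = M * d powr \<alpha>"
      using d F powr_mult[of "L\<^sup>2 / c" d \<alpha>] by (simp add: M_def)
    then have "(d + (L\<^sup>2 * d / c) powr \<alpha>) / d = 1 + M * d powr (- \<theta>)"
      using d by (simp add: add_divide_distrib powr_div[symmetric])
    then have "2 * (d + (L\<^sup>2 * d / c) powr \<alpha>) / d + 1 = 3 + 2 * (M * d powr (- \<theta>))"
      unfolding times_divide_eq_right[symmetric] by simp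
    then have "?N n \<le> 2 * real (card F) * (3 + 2 * (M * d powr (- \<theta>))) + 2"
      using num_approx_equilibria_le[OF ab n f' cont_f' L F m F']
      unfolding \<alpha>_def[symmetric] d_def[symmetric] by metis
    also have "\<dots> \<le> 2 * real (card F) * (3 * (B * d powr (- \<theta>)) + 2 * (M * d powr (- \<theta>)))
        + 2 * (B * d powr (- \<theta>))"
      using one M by (intro add_mono mult_left_mono) auto
    also have "\<dots> = C2 * d powr (- \<theta>)" by (simp add: C2_def algebra_simps)
    finally show "?N n \<le> C2 * mesh a b n powr (- \<theta>)" by (simp add: d_def)
  qed
  show ?thesis
    unfolding \<theta>_def[symmetric]
    using q \<open>C2 > 0\<close> main by (intro exI[of _ "q / 3"] exI[of _ C2]) auto
qed

end
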